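(* Let $\varphi\in L^\infty$, let $\alpha,\theta$ be inner functions, and let $$A=\begin{bmatrix}\varphi\theta & -1\\ \varphi\theta\bar\alpha & 0\end{bmatrix},\qquad B=\begin{bmatrix}\varphi & 0\\ \bar\alpha\varphi & -1\end{bmatrix}.$$ The map $$\mathcal N_*\colon\ker(D_\varphi^{\theta,\alpha})^*\to\ker(AP^++BP^-)^*,\qquad \mathcal N_*(g_-+\alpha\tilde g_+)=\begin{bmatrix}g_-\\ \tilde g_+\end{bmatrix},\quad g_-\in H^2_-,\ \tilde g_+\in H^2,$$ is an isomorphism.
   Context: $L^2=L^2(\mathbb T)$, $L^\infty=L^\infty(\mathbb T)$, $\mathbb T$ the unit circle; $H^2$ is the Hardy space of the unit disk viewed as a subspace of $L^2$, and $H^2_-=\bar z\,\overline{H^2}=L^2\ominus H^2$. $P^+$ and $P^-=I-P^+$ are the orthogonal projections of $L^2$ onto $H^2$ and $H^2_-$; they act componentwise on $L^2\oplus L^2$. Matrices in $(L^\infty)^{2\times2}$ are identified with the corresponding multiplication operators on $L^2\oplus L^2$; $(AP^++BP^-)^*$ is the Hilbert space adjoint of $AP^++BP^-$ on $L^2\oplus L^2$. For an inner function $\theta$, $K_\theta=H^2\ominus\theta H^2$, $(K_\theta)^\perp=L^2\ominus K_\theta=H^2_-\oplus\theta H^2$, and $Q_\theta$ is the orthogonal projection of $L^2$ onto $(K_\theta)^\perp$. For $\varphi\in L^\infty$ and inner $\alpha,\theta$, $D_\varphi^{\theta,\alpha}\colon (K_\theta)^\perp\to(K_\alpha)^\perp$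 is defined by $D_\varphi^{\theta,\alpha}f=Q_\alpha(\varphi f)$; its adjoint is $D_{\bar\varphi}^{\alpha,\theta}\colon(K_\alpha)^\perp\to(K_\theta)^\perp$. *)

theory Defs
  imports "HOL-Analysis.Analysis"
begin

section \<open>Complex inner product spaces\<close>

text \<open>The complex inner product is linear in its first argument. Norm and topology are those
  of the underlying real inner product space, whose inner product is the real part.\<close>

class complex_inner = real_inner +
  fixes scaleC :: "complex \<Rightarrow> 'a \<Rightarrow> 'a"  (infixr "*\<^sub>C" 75)
    and cinner :: "'a \<Rightarrow> 'a \<Rightarrow> complex"
  assumes scaleC_of_real: "complex_of_real r *\<^sub>C x = r *\<^sub>R x"
    and scaleC_add_right: "c *\<^sub>C (x + y) = c *\<^sub>C x + c *\<^sub>C y"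
    and scaleC_add_left: "(c + d) *\<^sub>C x = c *\<^sub>C x + d *\<^sub>C x"
    and scaleC_scaleC: "c *\<^sub>C d *\<^sub>C x = (c * d) *\<^sub>C x"
    and cinner_commute: "cinner x y = cnj (cinner y x)"
    and cinner_add_left: "cinner (x + y) z = cinner x z + cinner y z"
    and cinner_scaleC_left: "cinner (c *\<^sub>C x) y = c * cinner x y"
    and Re_cinner: "Re (cinner x y) = inner x y"

instantiation vec :: (complex_inner, finite) complex_inner
begin

definition scaleC_vec :: "complex \<Rightarrow> 'a ^ 'b \<Rightarrow> 'a ^ 'b"
  where "scaleC_vec c x = (\<chi> i. c *\<^sub>C (x $ i))"

definition cinner_vec :: "'a ^ 'b \<Rightarrow> 'a ^ 'b \<Rightarrow> complex"
  where "cinner_vec x y = (\<Sum>i\<in>UNIV. cinner (x $ i) (y $ i))"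

instance
proof
  fix r :: real and c d :: complex and x y z :: "'a ^ 'b"
  show "complex_of_real r *\<^sub>C x = r *\<^sub>R x"
    by (simp add: vec_eq_iff scaleC_vec_def scaleC_of_real)
  show "c *\<^sub>C (x + y) = c *\<^sub>C x + c *\<^sub>C y"
    by (simp add: vec_eq_iff scaleC_vec_def scaleC_add_right)
  show "(c + d) *\<^sub>C x = c *\<^sub>C x + d *\<^sub>C x"
    by (simp add: vec_eq_iff scaleC_vec_def scaleC_add_left)
  show "c *\<^sub>C d *\<^sub>C x = (c * d) *\<^sub>C x"
    by (simp add: vec_eq_iff scaleC_vec_def scaleC_scaleC)
  show "cinner x y = cnj (cinner y x)"
    unfolding cinner_vec_def cnj_sum by (rule sum.cong[OF refl cinner_commute])
  show "cinner (x + y) z = cinner x z + cinner y z"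
    by (simp add: cinner_vec_def cinner_add_left sum.distrib)
  show "cinner (c *\<^sub>C x) y = c * cinner x y"
    by (simp add: cinner_vec_def scaleC_vec_def cinner_scaleC_left sum_distrib_left)
  show "Re (cinner x y) = inner x y"
    by (simp add: cinner_vec_def inner_vec_def Re_cinner)
qed

end

definition orth_compl :: "'a::complex_inner set \<Rightarrow> 'a set"
  where "orth_compl S = {x. \<forall>y\<in>S. cinner x y = 0}"

definition orth_proj :: "'a::complex_inner set \<Rightarrow> 'a \<Rightarrow> 'a"
  where "orth_proj S x = (THE p. p \<in> S \<and> x - p \<in> orth_compl S)"

text \<open>Hilbert space adjoint of an operator \<open>T\<close> whose domain is the closed subspace \<open>V\<close>, evaluated
  at a vector of a closed subspace containing the range of \<open>T\<close>.\<close>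

definition adjoint_on :: "'a::complex_inner set \<Rightarrow> ('a \<Rightarrow> 'b::complex_inner) \<Rightarrow> 'b \<Rightarrow> 'a"
  where "adjoint_on V T g = (THE h. h \<in> V \<and> (\<forall>f\<in>V. cinner (T f) g = cinner f h))"

definition ker_on :: "'a set \<Rightarrow> ('a \<Rightarrow> 'b::zero) \<Rightarrow> 'a set"
  where "ker_on V T = {x \<in> V. T x = 0}"

definition clinear_on :: "'a::complex_inner set \<Rightarrow> ('a \<Rightarrow> 'b::complex_inner) \<Rightarrow> bool"
  where "clinear_on V T \<longleftrightarrow>
    (\<forall>x\<in>V. \<forall>y\<in>V. T (x + y) = T x + T y) \<and> (\<forall>c. \<forall>x\<in>V. T (c *\<^sub>C x) = c *\<^sub>C T x)"

text \<open>Isomorphism of normed spaces: a linear bijection, bounded with bounded inverse.\<close>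

definition isomorphism_on ::
  "'a::complex_inner set \<Rightarrow> 'b::complex_inner set \<Rightarrow> ('a \<Rightarrow> 'b) \<Rightarrow> bool"
  where "isomorphism_on V W T \<longleftrightarrow> clinear_on V T \<and> bij_betw T V W \<and>
    (\<exists>C. \<forall>x\<in>V. norm (T x) \<le> C * norm x) \<and>
    (\<exists>C. \<forall>x\<in>V. norm x \<le> C * norm (T x))"


section \<open>The spaces \<open>L\<^sup>2\<close> and \<open>L\<^sup>\<infinity>\<close> of the unit circle\<close>

text \<open>Normalized arc length, as a Borel measure on the complex plane carried by the unit circle.\<close>

definition circle :: "complex measure"
  where "circle = distr (uniform_measure lborel {0..<2 * pi}) borel cis"

lemma sets_circle [simp, measurable_cong]: "sets circle = sets borel"
  by (simp add: circle_def)

lemma space_circle [simp]: "space circle = UNIV"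
  by (simp add: circle_def)

lemma measurable_cis_borel: "cis \<in> borel_measurable borel"
  by (intro borel_measurable_continuous_onI) (auto intro!: continuous_intros)

lemma prob_circle: "emeasure circle UNIV = 1"
proof -
  have "emeasure circle UNIV = emeasure (uniform_measure lborel {0..<2 * pi}) UNIV"
    unfolding circle_def using measurable_cis_borel by (subst emeasure_distr) auto
  also have "\<dots> = 1"
    by (subst emeasure_uniform_measure)
       (auto intro!: ennreal_divide_self simp: ennreal_eq_0_iff not_le)
  finally show ?thesis .
qed

interpretation circle: finite_measure circle
  by standard (simp add: prob_circle)

definition sq_integrable :: "(complex \<Rightarrow> complex) \<Rightarrow> bool"
  where "sq_integrable f \<longleftrightarrow> f \<in> borel_measurable borel \<and> integrable circle (\<lambda>z. (cmod (f z))\<^sup>2)"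

definition ess_bounded :: "(complex \<Rightarrow> complex) \<Rightarrow> bool"
  where "ess_bounded f \<longleftrightarrow> f \<in> borel_measurable borel \<and> (\<exists>C. AE z in circle. cmod (f z) \<le> C)"

definition L2_rel :: "(complex \<Rightarrow> complex) \<Rightarrow> (complex \<Rightarrow> complex) \<Rightarrow> bool"
  where "L2_rel f g \<longleftrightarrow> sq_integrable f \<and> sq_integrable g \<and> (AE z in circle. f z = g z)"

definition Linf_rel :: "(complex \<Rightarrow> complex) \<Rightarrow> (complex \<Rightarrow> complex) \<Rightarrow> bool"
  where "Linf_rel f g \<longleftrightarrow> ess_bounded f \<and> ess_bounded g \<and> (AE z in circle. f z = g z)"

lemma sq_integrable_zero: "sq_integrable (\<lambda>_. 0)"
  by (simp add: sq_integrable_def)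

lemma ess_bounded_const: "ess_bounded (\<lambda>_. c)"
  by (auto simp: ess_bounded_def)

quotient_type L2 = "complex \<Rightarrow> complex" / partial: L2_rel
proof (rule part_equivpI)
  show "\<exists>f. L2_rel f f"
    using sq_integrable_zero by (auto simp: L2_rel_def)
  show "symp L2_rel"
    by (auto simp: L2_rel_def symp_def elim: AE_mp)
  show "transp L2_rel"
    unfolding transp_def L2_rel_def by (auto elim: AE_mp)
qed

quotient_type Linf = "complex \<Rightarrow> complex" / partial: Linf_rel
proof (rule part_equivpI)
  show "\<exists>f. Linf_rel f f"
    using ess_bounded_const by (auto simp: Linf_rel_def)
  show "symp Linf_rel"
    by (auto simp: Linf_rel_def symp_def elim: AE_mp)
  show "transp Linf_rel"
    unfolding transp_def Linf_rel_def by (auto elim: AE_mp)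
qed

lemma sq_integrable_add:
  assumes "sq_integrable f" "sq_integrable g"
  shows "sq_integrable (\<lambda>z. f z + g z)"
proof -
  have [measurable]: "f \<in> borel_measurable borel" "g \<in> borel_measurable borel"
    using assms by (auto simp: sq_integrable_def)
  have bd: "(cmod (f z + g z))\<^sup>2 \<le> 2 * (cmod (f z))\<^sup>2 + 2 * (cmod (g z))\<^sup>2" for z
  proof -
    have "(cmod (f z + g z))\<^sup>2 \<le> (cmod (f z) + cmod (g z))\<^sup>2"
      by (intro power_mono norm_triangle_ineq) auto
    also have "\<dots> \<le> 2 * (cmod (f z))\<^sup>2 + 2 * (cmod (g z))\<^sup>2"
      using zero_le_power2[of "cmod (f z) - cmod (g z)"]
      by (simp add: power2_eq_square algebra_simps)
    finally show ?thesis .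
  qed
  have "integrable circle (\<lambda>z. (cmod (f z + g z))\<^sup>2)"
  proof (rule Bochner_Integration.integrable_bound)
    show "integrable circle (\<lambda>z. 2 * (cmod (f z))\<^sup>2 + 2 * (cmod (g z))\<^sup>2)"
      using assms by (auto simp: sq_integrable_def)
  qed (use bd in auto)
  then show ?thesis by (simp add: sq_integrable_def)
qed

lemma sq_integrable_mult:
  assumes "ess_bounded \<phi>" "sq_integrable f"
  shows "sq_integrable (\<lambda>z. \<phi> z * f z)"
proof -
  have [measurable]: "f \<in> borel_measurable borel" "\<phi> \<in> borel_measurable borel"
    using assms by (auto simp: sq_integrable_def ess_bounded_def)
  obtain C where C: "AE z in circle. cmod (\<phi> z) \<le> C"
    using assms(1) by (auto simp: ess_bounded_def)
  have "integrable circle (\<lambda>z. (cmod (\<phi> z * f z))\<^sup>2)"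
  proof (rule Bochner_Integration.integrable_bound)
    show "integrable circle (\<lambda>z. C\<^sup>2 * (cmod (f z))\<^sup>2)"
      using assms by (auto simp: sq_integrable_def)
    show "AE z in circle. norm ((cmod (\<phi> z * f z))\<^sup>2) \<le> norm (C\<^sup>2 * (cmod (f z))\<^sup>2)"
      using C
    proof eventually_elim
      case (elim z)
      then have "(cmod (\<phi> z))\<^sup>2 \<le> C\<^sup>2"
        by (intro power_mono) auto
      then show ?case
        by (simp add: norm_mult power_mult_distrib mult_right_mono)
    qed
  qed auto
  then show ?thesis by (simp add: sq_integrable_def)
qed

lemma sq_integrable_scale: "sq_integrable f \<Longrightarrow> sq_integrable (\<lambda>z. c * f z)"
  by (rule sq_integrable_mult[OF ess_bounded_const])

lemma integrable_sq_prod: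
  assumes "sq_integrable f" "sq_integrable g"
  shows "integrable circle (\<lambda>z. f z * cnj (g z))"
proof -
  have [measurable]: "f \<in> borel_measurable borel" "g \<in> borel_measurable borel"
    using assms by (auto simp: sq_integrable_def)
  have [measurable]: "(\<lambda>z. cnj (g z)) \<in> borel_measurable borel"
    by (intro borel_measurable_continuous_on[of cnj] continuous_intros) simp
  show ?thesis
  proof (rule Bochner_Integration.integrable_bound)
    show "integrable circle (\<lambda>z. (cmod (f z))\<^sup>2 + (cmod (g z))\<^sup>2)"
      using assms by (auto simp: sq_integrable_def)
    have "cmod (f z) * cmod (g z) \<le> (cmod (f z))\<^sup>2 + (cmod (g z))\<^sup>2" for z
      using sum_squares_bound[of "cmod (f z)" "cmod (g z)"]
        mult_nonneg_nonneg[of "cmod (f z)" "cmod (g z)"] norm_ge_zero[of "f z"] norm_ge_zero[of "g z"]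
      by linarith
    then show "AE z in circle. norm (f z * cnj (g z)) \<le> norm ((cmod (f z))\<^sup>2 + (cmod (g z))\<^sup>2)"
      by (simp add: norm_mult)
  qed auto
qed

lemma measurable_cnj_comp: "f \<in> borel_measurable M \<Longrightarrow> (\<lambda>z. cnj (f z)) \<in> borel_measurable M"
  by (intro borel_measurable_continuous_on[of cnj] continuous_intros)

lemma ess_bounded_cnj: "ess_bounded f \<Longrightarrow> ess_bounded (\<lambda>z. cnj (f z))"
  by (auto simp: ess_bounded_def intro: measurable_cnj_comp)

lemma ess_bounded_add: "ess_bounded f \<Longrightarrow> ess_bounded g \<Longrightarrow> ess_bounded (\<lambda>z. f z + g z)"
proof -
  assume *: "ess_bounded f" "ess_bounded g"
  then obtain C D where "AE z in circle. cmod (f z) \<le> C" "AE z in circle. cmod (g z) \<le> D"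
    by (auto simp: ess_bounded_def)
  then have "AE z in circle. cmod (f z + g z) \<le> C + D"
    by eventually_elim (rule norm_triangle_mono)
  then show ?thesis using * by (auto simp: ess_bounded_def)
qed

lemma ess_bounded_mult: "ess_bounded f \<Longrightarrow> ess_bounded g \<Longrightarrow> ess_bounded (\<lambda>z. f z * g z)"
proof -
  assume *: "ess_bounded f" "ess_bounded g"
  then obtain C D where "AE z in circle. cmod (f z) \<le> C" "AE z in circle. cmod (g z) \<le> D"
    by (auto simp: ess_bounded_def)
  then have "AE z in circle. cmod (f z * g z) \<le> C * D"
    by eventually_elim (auto simp: norm_mult intro!: mult_mono order_trans[OF norm_ge_zero])
  then show ?thesis using * by (auto simp: ess_bounded_def)
qed

instantiation Linf :: comm_ring_1
begin

lift_definition zero_Linf :: Linf is "\<lambda>_. 0"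
  by (simp add: Linf_rel_def ess_bounded_const)

lift_definition one_Linf :: Linf is "\<lambda>_. 1"
  by (simp add: Linf_rel_def ess_bounded_const)

lift_definition plus_Linf :: "Linf \<Rightarrow> Linf \<Rightarrow> Linf" is "\<lambda>f g z. f z + g z"
  unfolding Linf_rel_def by (auto intro: ess_bounded_add)

lift_definition times_Linf :: "Linf \<Rightarrow> Linf \<Rightarrow> Linf" is "\<lambda>f g z. f z * g z"
  unfolding Linf_rel_def by (auto intro: ess_bounded_mult)

lift_definition uminus_Linf :: "Linf \<Rightarrow> Linf" is "\<lambda>f z. - f z"
  unfolding Linf_rel_def ess_bounded_def by auto

definition minus_Linf :: "Linf \<Rightarrow> Linf \<Rightarrow> Linf" where "minus_Linf f g = f + - g"

instance
proof
  fix a b c :: Linf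
  show "a * b * c = a * (b * c)"
    by transfer (auto simp: Linf_rel_def mult.assoc intro: ess_bounded_mult)
  show "a * b = b * a"
    by transfer (auto simp: Linf_rel_def mult.commute intro: ess_bounded_mult)
  show "1 * a = a"
    by transfer (auto simp: Linf_rel_def)
  show "a + b + c = a + (b + c)"
    by transfer (auto simp: Linf_rel_def add.assoc intro: ess_bounded_add)
  show "a + b = b + a"
    by transfer (auto simp: Linf_rel_def add.commute intro: ess_bounded_add)
  show "0 + a = a"
    by transfer (auto simp: Linf_rel_def)
  show "- a + a = 0"
    by transfer (auto simp: Linf_rel_def ess_bounded_const)
  show "a - b = a + - b"
    by (rule minus_Linf_def)
  show "(a + b) * c = a * c + b * c"
    by transfer (auto simp: Linf_rel_def algebra_simps intro: ess_bounded_add ess_bounded_mult)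
  show "(0::Linf) \<noteq> 1"
  proof transfer
    have "\<not> (AE z in circle. False)"
      using prob_circle by (auto simp: AE_iff_measurable[OF _ refl])
    then show "\<not> Linf_rel (\<lambda>_. 0) (\<lambda>_. 1)"
      by (auto simp: Linf_rel_def)
  qed
qed

end

lift_definition cnj_Linf :: "Linf \<Rightarrow> Linf" is "\<lambda>f z. cnj (f z)"
  unfolding Linf_rel_def by (auto intro: ess_bounded_cnj)

lift_definition unimodular :: "Linf \<Rightarrow> bool" is "\<lambda>f. AE z in circle. cmod (f z) = 1"
  unfolding Linf_rel_def by (auto elim: AE_mp)

lift_definition L2_of_Linf :: "Linf \<Rightarrow> L2" is "\<lambda>f. f"
proof -
  have "sq_integrable f" if "ess_bounded f" for f
    using sq_integrable_mult[OF that, of "\<lambda>_. 1"] by (simp add: sq_integrable_def)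
  then show "L2_rel f g" if "Linf_rel f g" for f g
    using that by (auto simp: L2_rel_def Linf_rel_def)
qed

instantiation L2 :: ab_group_add
begin

lift_definition zero_L2 :: L2 is "\<lambda>_. 0"
  by (simp add: L2_rel_def sq_integrable_zero)

lift_definition plus_L2 :: "L2 \<Rightarrow> L2 \<Rightarrow> L2" is "\<lambda>f g z. f z + g z"
  unfolding L2_rel_def by (auto intro: sq_integrable_add)

lift_definition uminus_L2 :: "L2 \<Rightarrow> L2" is "\<lambda>f z. - f z"
  unfolding L2_rel_def sq_integrable_def by auto

definition minus_L2 :: "L2 \<Rightarrow> L2 \<Rightarrow> L2" where "minus_L2 f g = f + - g"

instance
proof
  fix f g h :: L2
  show "f + g + h = f + (g + h)"
    by transfer (auto simp: L2_rel_def add.assoc intro!: sq_integrable_add)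
  show "f + g = g + f"
    by transfer (auto simp: L2_rel_def add.commute intro!: sq_integrable_add)
  show "0 + f = f"
    by transfer (auto simp: L2_rel_def)
  show "- f + f = 0"
    by transfer (auto simp: L2_rel_def sq_integrable_zero)
  show "f - g = f + - g"
    by (rule minus_L2_def)
qed

end

instantiation L2 :: complex_inner
begin

lift_definition scaleC_L2 :: "complex \<Rightarrow> L2 \<Rightarrow> L2" is "\<lambda>c f z. c * f z"
  unfolding L2_rel_def by (auto intro: sq_integrable_scale)

lift_definition cinner_L2 :: "L2 \<Rightarrow> L2 \<Rightarrow> complex" is "\<lambda>f g. \<integral>z. f z * cnj (g z) \<partial>circle"
proof -
  fix f f' g g' assume "L2_rel f f'" "L2_rel g g'"
  then have ae: "AE z in circle. f z = f' z" "AE z in circle. g z = g' z"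
    and int: "integrable circle (\<lambda>z. f z * cnj (g z))" "integrable circle (\<lambda>z. f' z * cnj (g' z))"
    by (auto simp: L2_rel_def intro: integrable_sq_prod)
  show "(\<integral>z. f z * cnj (g z) \<partial>circle) = (\<integral>z. f' z * cnj (g' z) \<partial>circle)"
  proof (rule integral_cong_AE)
    show "AE z in circle. f z * cnj (g z) = f' z * cnj (g' z)"
      using ae by eventually_elim simp
  qed (use int in \<open>auto dest: borel_measurable_integrable\<close>)
qed

definition scaleR_L2 :: "real \<Rightarrow> L2 \<Rightarrow> L2" where "scaleR_L2 r f = complex_of_real r *\<^sub>C f"
definition inner_L2 :: "L2 \<Rightarrow> L2 \<Rightarrow> real" where "inner_L2 f g = Re (cinner f g)"
definition norm_L2 :: "L2 \<Rightarrow> real" where "norm_L2 f = sqrt (inner f f)"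
definition sgn_L2 :: "L2 \<Rightarrow> L2" where "sgn_L2 f = inverse (norm f) *\<^sub>R f"
definition dist_L2 :: "L2 \<Rightarrow> L2 \<Rightarrow> real" where "dist_L2 f g = norm (f - g)"
definition uniformity_L2 :: "(L2 \<times> L2) filter"
  where "uniformity_L2 = (INF e\<in>{0<..}. principal {(f, g). dist f g < e})"
definition open_L2 :: "L2 set \<Rightarrow> bool"
  where "open_L2 U \<longleftrightarrow> (\<forall>f\<in>U. eventually (\<lambda>(f', g). f' = f \<longrightarrow> g \<in> U) uniformity)"

instance
proof
  fix a b :: real and c d :: complex and f g h :: L2 and U :: "L2 set"
  have addr: "c *\<^sub>C (f + g) = c *\<^sub>C f + c *\<^sub>C g" for c and f g :: L2
    by transfer (auto simp: L2_rel_def algebra_simps intro!: sq_integrable_add sq_integrable_scale)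
  have addl: "(c + d) *\<^sub>C f = c *\<^sub>C f + d *\<^sub>C f" for c d and f :: L2
    by transfer (auto simp: L2_rel_def distrib_right intro: sq_integrable_add sq_integrable_scale)
  have scsc: "c *\<^sub>C d *\<^sub>C f = (c * d) *\<^sub>C f" for c d and f :: L2
    by transfer (auto simp: L2_rel_def mult.assoc intro: sq_integrable_scale)
  show "c *\<^sub>C (f + g) = c *\<^sub>C f + c *\<^sub>C g" "(c + d) *\<^sub>C f = c *\<^sub>C f + d *\<^sub>C f"
    "c *\<^sub>C d *\<^sub>C f = (c * d) *\<^sub>C f"
    by (fact addr addl scsc)+
  show "a *\<^sub>R (f + g) = a *\<^sub>R f + a *\<^sub>R g" "(a + b) *\<^sub>R f = a *\<^sub>R f + b *\<^sub>R f"
    "a *\<^sub>R b *\<^sub>R f = (a * b) *\<^sub>R f"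
    by (simp_all add: scaleR_L2_def addr addl scsc)
  show "1 *\<^sub>R f = f"
    unfolding scaleR_L2_def by transfer (auto simp: L2_rel_def)
  show "complex_of_real a *\<^sub>C f = a *\<^sub>R f"
    by (simp add: scaleR_L2_def)
  show "sgn f = inverse (norm f) *\<^sub>R f"
    by (rule sgn_L2_def)
  show "dist f g = norm (f - g)"
    by (rule dist_L2_def)
  show "uniformity = (INF e\<in>{0<..}. principal {(f::L2, g). dist f g < e})"
    by (rule uniformity_L2_def)
  show "open U \<longleftrightarrow> (\<forall>f\<in>U. eventually (\<lambda>(f', g). f' = f \<longrightarrow> g \<in> U) uniformity)"
    by (rule open_L2_def)
  show comm: "cinner f g = cnj (cinner g f)" for f g :: L2
  proof transfer
    fix u v :: "complex \<Rightarrow> complex"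
    have "(\<integral>z. u z * cnj (v z) \<partial>circle) = (\<integral>z. cnj (v z * cnj (u z)) \<partial>circle)"
      by (simp add: mult.commute)
    then show "(\<integral>z. u z * cnj (v z) \<partial>circle) = cnj (\<integral>z. v z * cnj (u z) \<partial>circle)"
      by (simp only: Bochner_Integration.integral_cnj)
  qed
  have cadd: "cinner (f + g) h = cinner f h + cinner g h" for f g h :: L2
    by transfer (auto simp: L2_rel_def distrib_right integrable_sq_prod)
  have cscale: "cinner (c *\<^sub>C f) g = c * cinner f g" for c and f g :: L2
    by transfer (auto simp: mult.assoc)
  show "cinner (f + g) h = cinner f h + cinner g h" "cinner (c *\<^sub>C f) g = c * cinner f g"
    by (fact cadd cscale)+
  show "Re (cinner f g) = inner f g"
    by (simp add: inner_L2_def)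
  show "inner f g = inner g f"
    unfolding inner_L2_def by (subst comm) simp
  show "inner (f + g) h = inner f h + inner g h"
    by (simp add: inner_L2_def cadd)
  show "inner (a *\<^sub>R f) g = a * inner f g"
    by (simp add: inner_L2_def scaleR_L2_def cscale)
  show "norm f = sqrt (inner f f)"
    by (rule norm_L2_def)
  have inner_self: "Re (\<integral>z. u z * cnj (u z) \<partial>circle) = (\<integral>z. (cmod (u z))\<^sup>2 \<partial>circle)" for u
    by (simp add: complex_norm_square[symmetric] del: of_real_power)
  show "0 \<le> inner f f"
    unfolding inner_L2_def by transfer (simp add: inner_self)
  show "inner f f = 0 \<longleftrightarrow> f = 0"
    unfolding inner_L2_def
  proof transfer
    fix u assume "L2_rel u u"
    then have u: "sq_integrable u" by (simp add: L2_rel_def)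
    then have "(\<integral>z. (cmod (u z))\<^sup>2 \<partial>circle) = 0 \<longleftrightarrow> (AE z in circle. (cmod (u z))\<^sup>2 = 0)"
      by (intro integral_nonneg_eq_0_iff_AE) (auto simp: sq_integrable_def)
    with u show "Re (\<integral>z. u z * cnj (u z) \<partial>circle) = 0 \<longleftrightarrow> L2_rel u (\<lambda>_. 0)"
      by (simp add: inner_self L2_rel_def sq_integrable_zero)
  qed
qed

end

lift_definition mult_op :: "Linf \<Rightarrow> L2 \<Rightarrow> L2"  (infixr "\<cdot>" 75) is "\<lambda>\<phi> f z. \<phi> z * f z"
  unfolding L2_rel_def Linf_rel_def by (auto intro: sq_integrable_mult)

definition matrix_mult_op :: "Linf ^ 'n ^ 'm \<Rightarrow> L2 ^ 'n \<Rightarrow> L2 ^ 'm"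
  where "matrix_mult_op A u = (\<chi> i. \<Sum>j\<in>UNIV. (A $ i $ j) \<cdot> (u $ j))"


section \<open>Hardy spaces and inner functions\<close>

lift_definition fourier_coeff :: "L2 \<Rightarrow> int \<Rightarrow> complex"
  is "\<lambda>f n. \<integral>z. f z * z powi (- n) \<partial>circle"
proof -
  fix f g assume *: "L2_rel f g"
  then have [measurable]: "f \<in> borel_measurable borel" "g \<in> borel_measurable borel"
    by (auto simp: L2_rel_def sq_integrable_def)
  have [measurable]: "(\<lambda>z::complex. z powi k) \<in> borel_measurable borel" for k
    by (simp add: power_int_def)
  have "(\<integral>z. f z * z powi (- n) \<partial>circle) = (\<integral>z. g z * z powi (- n) \<partial>circle)" for n
    using * by (intro integral_cong_AE) (auto simp: L2_rel_def)
  then show "(\<lambda>n. \<integral>z. f z * z powi (- n) \<partial>circle) = (\<lambda>n. \<integral>z. g z * z powi (- n) \<partial>circle)"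
    by simp
qed

text \<open>The function \<open>\<Sum>n. a\<^sub>n z\<^sup>n\<close> of the Hardy space of the disk is identified with its boundary
  function, whose Fourier coefficients are \<open>a\<^sub>n\<close> for \<open>n \<ge> 0\<close> and \<open>0\<close> for \<open>n < 0\<close>.\<close>

definition H2 :: "L2 set"
  where "H2 = {f. \<forall>n<0. fourier_coeff f n = 0}"

definition H2_minus :: "L2 set"
  where "H2_minus = orth_compl H2"

definition P_plus :: "L2 \<Rightarrow> L2" where "P_plus = orth_proj H2"
definition P_minus :: "L2 \<Rightarrow> L2" where "P_minus f = f - P_plus f"

definition inner_function :: "Linf \<Rightarrow> bool"
  where "inner_function \<theta> \<longleftrightarrow> L2_of_Linf \<theta> \<in> H2 \<and> unimodular \<theta>"

definition model_space :: "Linf \<Rightarrow> L2 set"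
  where "model_space \<theta> = H2 \<inter> orth_compl ((\<cdot>) \<theta> ` H2)"


section \<open>Dual truncated Toeplitz operators and paired operators\<close>

definition K_perp :: "Linf \<Rightarrow> L2 set"
  where "K_perp \<theta> = orth_compl (model_space \<theta>)"

text \<open>The domain of \<open>dual_toeplitz \<theta> \<alpha> \<phi>\<close> is \<open>K_perp \<theta>\<close>, its codomain \<open>K_perp \<alpha>\<close>.\<close>

definition dual_toeplitz :: "Linf \<Rightarrow> Linf \<Rightarrow> Linf \<Rightarrow> L2 \<Rightarrow> L2"
  where "dual_toeplitz \<theta> \<alpha> \<phi> f = orth_proj (K_perp \<alpha>) (\<phi> \<cdot> f)"

definition paired_op :: "Linf ^ 2 ^ 2 \<Rightarrow> Linf ^ 2 ^ 2 \<Rightarrow> L2 ^ 2 \<Rightarrow> L2 ^ 2"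
  where "paired_op A B u =
    matrix_mult_op A (\<chi> i. P_plus (u $ i)) + matrix_mult_op B (\<chi> i. P_minus (u $ i))"

definition N_star :: "Linf \<Rightarrow> L2 \<Rightarrow> L2 ^ 2"
  where "N_star \<alpha> g =
    (THE u. u $ 1 \<in> H2_minus \<and> u $ 2 \<in> H2 \<and> g = u $ 1 + \<alpha> \<cdot> (u $ 2))"

end

theory Submission
  imports Defs
begin

text \<open>
  Write \<open>H\<^sub>-\<close> for \<open>H2_minus\<close>. The theorem rests on the orthogonal decomposition
  \<open>K_perp \<alpha> = H\<^sub>- + \<alpha> \<cdot> H2\<close> (\<open>K_perp_eq\<close>). Since \<open>\<alpha>\<close> is unimodular, a vector
  \<open>g = m + \<alpha> \<cdot> p\<close> determines \<open>m\<close> and \<open>p\<close>, and its norm is that of the pair \<open>(m, p)\<close>; so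
  \<open>N_star \<alpha>\<close> is a linear isometry on \<open>K_perp \<alpha>\<close>, and only its action on the two
  kernels has to be understood.

  Both kernels are cut out by the same condition on \<open>g\<close>, namely that \<open>g\<close> is orthogonal to
  \<open>\<phi> \<cdot> f\<close> for all \<open>f \<in> K_perp \<theta>\<close>. For the dual Toeplitz operator this is
  immediate, because the projection onto \<open>K_perp \<alpha>\<close> may be dropped when pairing with
  \<open>g \<in> K_perp \<alpha>\<close> (\<open>ker_dual_toeplitz_adjoint\<close>). For the paired operator with
  \<open>v = (m, p)\<close> and \<open>g = m + \<alpha> \<cdot> p\<close>, the shape of \<open>A\<close> and \<open>B\<close> gives
  \[ \langle (A P^+ + B P^-) u, v\rangle =
     \langle \varphi (\theta P^+ u_1 + P^- u_1), g\rangle - \langle u_2, P^+ m + P^- p\rangle. \]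
  The components \<open>u\<^sub>1\<close> and \<open>u\<^sub>2\<close> vary independently. The second term vanishes for all \<open>u\<^sub>2\<close> iff
  \<open>m \<in> H\<^sub>-\<close> and \<open>p \<in> H2\<close>, and \<open>\<theta> P\<^sup>+ u\<^sub>1 + P\<^sup>- u\<^sub>1\<close> runs through
  \<open>K_perp \<theta>\<close> (\<open>ker_paired_adjoint\<close>).

  Three analytic facts support this. The projections exist because \<open>L\<^sup>2\<close> is complete
  (the Riesz--Fischer theorem). The decomposition of \<open>K_perp \<alpha>\<close> needs
  \<open>\<alpha> \<cdot> H2 \<subseteq> H2\<close>, where \<open>H2\<close> is given by vanishing negative Fourier coefficients.
  To obtain this inclusion one must know that \<open>H\<^sub>-\<close> consists of all vectors orthogonal to the
  \<open>z\<^sup>n\<close> with \<open>n \<ge> 0\<close>, that is, that the trigonometric system is complete. The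
  latter is proved here for integrable functions from the Stone--Weierstrass theorem.
\<close>

section \<open>Orthogonal projections in complex Hilbert spaces\<close>

lemma cinner_add_right: "cinner x (y + z) = cinner x y + cinner (x::'a::complex_inner) z"
  by (subst cinner_commute) (simp add: cinner_add_left cinner_commute[of x y] cinner_commute[of x z])

lemma cinner_scaleC_right: "cinner x (c *\<^sub>C y) = cnj c * cinner (x::'a::complex_inner) y"
  by (subst cinner_commute) (simp add: cinner_scaleC_left cinner_commute[of x y])

lemma cinner_zero_left [simp]: "cinner 0 (y::'a::complex_inner) = 0"
  using cinner_add_left[of 0 0 y] by simp

lemma cinner_zero_right [simp]: "cinner (y::'a::complex_inner) 0 = 0"
  using cinner_add_right[of y 0 0] by simp

lemma cinner_minus_left [simp]: "cinner (- x) (y::'a::complex_inner) = - cinner x y"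
  using cinner_add_left[of "- x" x y] by (simp add: add_eq_0_iff)

lemma cinner_minus_right [simp]: "cinner (x::'a::complex_inner) (- y) = - cinner x y"
  using cinner_add_right[of x "- y" y] by (simp add: add_eq_0_iff)

lemma cinner_diff_left: "cinner (x - y) z = cinner x z - cinner (y::'a::complex_inner) z"
  using cinner_add_left[of x "- y" z] by simp

lemma cinner_diff_right: "cinner x (y - z) = cinner x y - cinner (x::'a::complex_inner) z"
  using cinner_add_right[of x y "- z"] by simp

text \<open>The complex inner product is recovered from the real one, so continuity and orthogonality
  can be transferred from the real theory.\<close>

lemma cinner_eq_inner: "cinner x y = Complex (inner x y) (inner x (\<i> *\<^sub>C (y::'a::complex_inner)))"
  by (simp add: complex_eq_iff cinner_scaleC_right flip: Re_cinner)

lemma continuous_on_cinner_left: "continuous_on S (\<lambda>x. cinner x (y::'a::complex_inner))"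
  unfolding cinner_eq_inner Complex_eq by (intro continuous_intros)

lemma cinner_self_eq_0: "cinner x x = 0 \<Longrightarrow> (x::'a::complex_inner) = 0"
  using Re_cinner[of x x] by simp

lemma norm_eq_cinner: "(norm (x::'a::complex_inner))\<^sup>2 = Re (cinner x x)"
  by (simp add: Re_cinner power2_norm_eq_inner)

definition csubspace :: "'a::complex_inner set \<Rightarrow> bool"
  where "csubspace V \<longleftrightarrow> 0 \<in> V \<and> (\<forall>x\<in>V. \<forall>y\<in>V. x + y \<in> V) \<and> (\<forall>c. \<forall>x\<in>V. c *\<^sub>C x \<in> V)"

lemma csubspace_zero: "csubspace V \<Longrightarrow> 0 \<in> V"
  and csubspace_add: "csubspace V \<Longrightarrow> x \<in> V \<Longrightarrow> y \<in> V \<Longrightarrow> x + y \<in> V"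
  and csubspace_scaleC: "csubspace V \<Longrightarrow> x \<in> V \<Longrightarrow> c *\<^sub>C x \<in> V"
  by (simp_all add: csubspace_def)

lemma csubspace_scaleR: "csubspace V \<Longrightarrow> x \<in> V \<Longrightarrow> r *\<^sub>R x \<in> V"
  using csubspace_scaleC[of V x "of_real r"] by (simp add: scaleC_of_real)

lemma csubspace_diff: "csubspace V \<Longrightarrow> x \<in> V \<Longrightarrow> y \<in> V \<Longrightarrow> x - y \<in> V"
  using csubspace_add[of V x "- y"] csubspace_scaleR[of V y "- 1"] by simp

lemma csubspace_orth_compl: "csubspace (orth_compl S)"
  by (auto simp: csubspace_def orth_compl_def cinner_add_left cinner_scaleC_left)

lemma closed_orth_compl: "closed (orth_compl S)"
proof -
  have "orth_compl S = (\<Inter>y\<in>S. {x. cinner x y = 0})"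
    by (auto simp: orth_compl_def)
  then show ?thesis
    by (auto intro!: closed_Collect_eq continuous_on_cinner_left)
qed

lemma orth_complD: "x \<in> orth_compl S \<Longrightarrow> y \<in> S \<Longrightarrow> cinner x y = 0 \<and> cinner y x = 0"
  by (auto simp: orth_compl_def cinner_commute[of y x])

lemma orth_compl_self: "x \<in> S \<Longrightarrow> x \<in> orth_compl S \<Longrightarrow> x = 0"
  by (auto simp: orth_compl_def intro: cinner_self_eq_0)

text \<open>The variational principle: a quadratic polynomial in \<open>t\<close> that is minimal at
  \<open>t = 0\<close> has no linear term.\<close>

lemma inner_eq_0_if_norm_minimal:
  fixes r s :: "'a::real_inner"
  assumes "\<And>t. norm r \<le> norm (r - t *\<^sub>R s)"
  shows "inner r s = 0"
proof (cases "s = 0")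
  case False
  \<comment> \<open>the minimizer of the quadratic polynomial \<open>t \<mapsto> \<parallel>r - t s\<parallel>\<^sup>2\<close>\<close>
  define t where "t = inner r s / inner s s"
  have s: "inner s s > 0" using False by simp
  have "inner r r \<le> inner (r - t *\<^sub>R s) (r - t *\<^sub>R s)"
    using assms[of t] by (simp add: norm_le)
  also have "\<dots> = inner r r - 2 * t * inner r s + t\<^sup>2 * inner s s"
    by (simp add: inner_diff_left inner_diff_right inner_commute power2_eq_square algebra_simps)
  also have "\<dots> = inner r r - (inner r s)\<^sup>2 / inner s s"
    using s by (simp add: t_def power2_eq_square divide_simps)
  finally show ?thesis using s by (simp add: divide_le_0_iff)
qed simp

text \<open>By the parallelogram law every minimizing sequence for the distance is Cauchy: midpoints of
  its members stay in \<open>V\<close>, hence at distance at least \<open>d\<close> from \<open>x\<close>.\<close>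

lemma nearest_point_exists:
  fixes V :: "'a::{complex_inner, complete_space} set"
  assumes V: "csubspace V" "closed V"
  obtains p where "p \<in> V" "\<And>y. y \<in> V \<Longrightarrow> dist x p \<le> dist x y"
proof -
  define d where "d = infdist x V"
  have ne: "V \<noteq> {}" using csubspace_zero[OF V(1)] by auto
  have d: "d \<le> dist x y" if "y \<in> V" for y using that by (simp add: d_def infdist_le)
  have d0: "0 \<le> d" by (simp add: d_def infdist_nonneg)
  have "\<exists>y\<in>V. (dist x y)\<^sup>2 < d\<^sup>2 + inverse (Suc n)" for n :: nat
  proof -
    have "d < sqrt (d\<^sup>2 + inverse (Suc n))" using d0 by (intro real_less_rsqrt) simp
    then obtain y where "y \<in> V" "dist x y < sqrt (d\<^sup>2 + inverse (Suc n))"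
      using ne unfolding d_def infdist_notempty[OF ne] by (subst (asm) cINF_less_iff) auto
    moreover from this(2) have "(dist x y)\<^sup>2 < (sqrt (d\<^sup>2 + inverse (Suc n)))\<^sup>2"
      by (intro power_strict_mono) auto
    moreover have "0 \<le> d\<^sup>2 + inverse (real (Suc n))" by simp
    ultimately show ?thesis by (metis real_sqrt_pow2)
  qed
  then obtain y where y: "\<And>n. y n \<in> V" "\<And>n. (dist x (y n))\<^sup>2 < d\<^sup>2 + inverse (Suc n)"
    by metis
  have close: "(dist (y m) (y n))\<^sup>2 \<le> 2 * (inverse (Suc m) + inverse (Suc n))" for m n :: nat
  proof -
    let ?a = "x - y m" and ?b = "x - y n" and ?c = "(1/2) *\<^sub>R (y m + y n)"
    have c: "?c \<in> V" using y V by (intro csubspace_scaleR csubspace_add)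
    have "?a + ?b = 2 *\<^sub>R (x - ?c)" by (simp add: algebra_simps scaleR_2)
    then have "4 * d\<^sup>2 \<le> (norm (?a + ?b))\<^sup>2"
      using power_mono[OF d[OF c] d0, of 2] by (simp add: dist_norm power_mult_distrib)
    moreover have "(norm (?a + ?b))\<^sup>2 + (norm (?a - ?b))\<^sup>2 = 2 * (norm ?a)\<^sup>2 + 2 * (norm ?b)\<^sup>2"
      unfolding power2_norm_eq_inner by (simp add: inner_add inner_diff)
    moreover have "norm (?a - ?b) = dist (y m) (y n)"
      by (simp add: dist_norm norm_minus_commute)
    ultimately show ?thesis
      using y(2)[of m] y(2)[of n] by (simp add: dist_norm)
  qed
  have "Cauchy y"
  proof (rule metric_CauchyI)
    fix e :: real assume "0 < e"
    then obtain N where N: "inverse (real (Suc N)) < e\<^sup>2 / 4"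
      using reals_Archimedean[of "e\<^sup>2 / 4"] by auto
    have "dist (y m) (y n) < e" if "m \<ge> N" "n \<ge> N" for m n
    proof -
      have le: "inverse (real (Suc m)) \<le> inverse (real (Suc N))"
           "inverse (real (Suc n)) \<le> inverse (real (Suc N))" using that by auto
      then have "inverse (real (Suc m)) < e\<^sup>2 / 4" "inverse (real (Suc n)) < e\<^sup>2 / 4"
        using le_less_trans[OF le(1) N] le_less_trans[OF le(2) N] by blast+
      then have "2 * (inverse (real (Suc m)) + inverse (real (Suc n))) < e\<^sup>2"
        by (simp only: distrib_left)
      then have "(dist (y m) (y n))\<^sup>2 < e\<^sup>2"
        using close[of m n] by (rule le_less_trans[rotated])
      then show ?thesis using \<open>0 < e\<close> by (simp add: power_less_imp_less_base)
    qed
    then show "\<exists>M. \<forall>m\<ge>M. \<forall>n\<ge>M. dist (y m) (y n) < e" by blast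
  qed
  then obtain p where p: "y \<longlonglongrightarrow> p"
    using Cauchy_convergent_iff convergent_def by blast
  have "p \<in> V" using closed_sequentially[OF V(2) _ p] y(1) by blast
  moreover have "(dist x p)\<^sup>2 \<le> d\<^sup>2"
  proof (rule LIMSEQ_le)
    show "(\<lambda>n. (dist x (y n))\<^sup>2) \<longlonglongrightarrow> (dist x p)\<^sup>2" by (intro tendsto_intros p)
    show "(\<lambda>n. d\<^sup>2 + inverse (real (Suc n))) \<longlonglongrightarrow> d\<^sup>2"
      using tendsto_add[OF tendsto_const LIMSEQ_inverse_real_of_nat, of "d\<^sup>2"] by simp
  qed (use y(2) in \<open>auto intro: less_imp_le\<close>)
  then have "dist x p \<le> d" using d0 by (simp add: power2_le_iff_abs_le)
  ultimately show thesis using that d by (meson order_trans)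
qed

lemma orth_proj_unique:
  assumes "csubspace V" "p \<in> V" "x - p \<in> orth_compl V"
  shows "orth_proj V x = p"
  unfolding orth_proj_def
proof (rule the_equality)
  fix q assume q: "q \<in> V \<and> x - q \<in> orth_compl V"
  then have "q - p \<in> V" using assms by (auto intro: csubspace_diff)
  moreover have "q - p \<in> orth_compl V"
    using csubspace_diff[OF csubspace_orth_compl, of "x - p" V "x - q"] q assms by simp
  ultimately show "q = p" using orth_compl_self by fastforce
qed (use assms in auto)

text \<open>Minimality gives orthogonality for the real inner product; as \<open>V\<close> is closed under
  multiplication by \<open>\<i>\<close>, the imaginary part vanishes as well.\<close>

theorem orth_proj:
  fixes V :: "'a::{complex_inner, complete_space} set"
  assumes V: "csubspace V" "closed V"
  shows "orth_proj V x \<in> V" "x - orth_proj V x \<in> orth_compl V"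
proof -
  obtain p where p: "p \<in> V" and min: "\<And>y. y \<in> V \<Longrightarrow> dist x p \<le> dist x y"
    using nearest_point_exists[OF V, of x] by blast
  have re: "inner (x - p) s = 0" if s: "s \<in> V" for s
  proof (rule inner_eq_0_if_norm_minimal)
    fix t
    show "norm (x - p) \<le> norm (x - p - t *\<^sub>R s)"
      using min[of "p + t *\<^sub>R s"] V s p
      by (simp add: dist_norm csubspace_add csubspace_scaleR diff_diff_eq)
  qed
  have "x - p \<in> orth_compl V"
    using re V(1) by (auto simp: orth_compl_def cinner_eq_inner complex_eq_iff csubspace_scaleC)
  with orth_proj_unique[OF V(1) p] p
  show "orth_proj V x \<in> V" "x - orth_proj V x \<in> orth_compl V" by auto
qed

text \<open>An adjoint is a definite description, so a concrete vector \<open>h\<close> representing the functional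
  is needed to give it a value; once one exists, the kernel condition no longer mentions \<open>h\<close>.\<close>

lemma adjoint_on_eq_0_iff:
  assumes V: "csubspace V" and h: "h \<in> V" "\<And>f. f \<in> V \<Longrightarrow> cinner (T f) g = cinner f h"
  shows "adjoint_on V T g = 0 \<longleftrightarrow> (\<forall>f\<in>V. cinner (T f) g = 0)"
proof -
  have "adjoint_on V T g = h"
    unfolding adjoint_on_def
  proof (rule the_equality)
    fix k assume k: "k \<in> V \<and> (\<forall>f\<in>V. cinner (T f) g = cinner f k)"
    then have "k - h \<in> V" using V h by (auto intro: csubspace_diff)
    moreover from this have "cinner (k - h) (k - h) = 0"
      using k h by (metis cinner_diff_right diff_self)
    ultimately show "k = h" using cinner_self_eq_0 by fastforce
  qed (use h in auto)
  then show ?thesis using h by (auto intro: cinner_self_eq_0)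
qed

section \<open>Completeness of $L^2$\<close>

lemma exists_L2_representative:
  obtains u where "sq_integrable u" "f = abs_L2 u"
proof -
  have "L2_rel (rep_L2 f) (rep_L2 f)" "f = abs_L2 (rep_L2 f)"
    using Quotient3_rep_reflp[OF Quotient3_L2] Quotient3_abs_rep[OF Quotient3_L2] by metis+
  then show thesis using that by (auto simp: L2_rel_def)
qed

lemma L2_relI: "sq_integrable u \<Longrightarrow> L2_rel u u"
  by (simp add: L2_rel_def)

lemma sq_integrable_diff:
  assumes "sq_integrable u" "sq_integrable v"
  shows "sq_integrable (\<lambda>z. u z - v z)"
  using sq_integrable_add[OF assms(1) sq_integrable_scale[OF assms(2), of "- 1"]] by simp

lemma abs_L2_diff:
  assumes "sq_integrable u" "sq_integrable v"
  shows "abs_L2 u - abs_L2 v = abs_L2 (\<lambda>z. u z - v z)"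
proof -
  have v: "sq_integrable (\<lambda>z. - v z)" using sq_integrable_scale[OF assms(2), of "- 1"] by simp
  show ?thesis
    using assms v by (simp add: minus_L2_def uminus_L2.abs_eq plus_L2.abs_eq L2_relI)
qed

lemma norm_abs_L2:
  assumes "sq_integrable u"
  shows "(norm (abs_L2 u))\<^sup>2 = (\<integral>z. (cmod (u z))\<^sup>2 \<partial>circle)"
    and "ennreal ((norm (abs_L2 u))\<^sup>2) = (\<integral>\<^sup>+z. ennreal ((cmod (u z))\<^sup>2) \<partial>circle)"
proof -
  have "(norm (abs_L2 u))\<^sup>2 = inner (abs_L2 u) (abs_L2 u)"
    by (simp add: power2_norm_eq_inner)
  also have "\<dots> = Re (\<integral>z. u z * cnj (u z) \<partial>circle)"
    using assms by (simp add: inner_L2_def cinner_L2.abs_eq L2_relI)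
  also have "\<dots> = (\<integral>z. (cmod (u z))\<^sup>2 \<partial>circle)"
    by (simp add: complex_norm_square[symmetric] del: of_real_power)
  finally show *: "(norm (abs_L2 u))\<^sup>2 = (\<integral>z. (cmod (u z))\<^sup>2 \<partial>circle)" .
  show "ennreal ((norm (abs_L2 u))\<^sup>2) = (\<integral>\<^sup>+z. ennreal ((cmod (u z))\<^sup>2) \<partial>circle)"
    unfolding * using assms by (subst nn_integral_eq_integral) (auto simp: sq_integrable_def)
qed

lemma ennreal_power2_le_imp_le:
  assumes "x\<^sup>2 \<le> (ennreal b)\<^sup>2" "0 \<le> b"
  shows "x \<le> ennreal b"
proof (cases x)
  case (real r)
  have "ennreal (r\<^sup>2) \<le> ennreal (b\<^sup>2)"
    using assms(1) real(1) assms(2) unfolding real(2) by (simp only: ennreal_power)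
  then have "r\<^sup>2 \<le> b\<^sup>2" by (subst (asm) ennreal_le_iff) simp_all
  then have "r \<le> b" using assms(2) by (rule power2_le_imp_le)
  then show ?thesis unfolding real(2) by (rule ennreal_leI)
next
  case top
  have "(top::ennreal)\<^sup>2 = top" by (simp add: power2_eq_square)
  then show ?thesis
    using assms unfolding top by (simp only: ennreal_power top_unique ennreal_neq_top)
qed

text \<open>Cauchy--Schwarz against the constant \<open>1\<close>, with total mass one.\<close>

lemma nn_integral_circle_le_norm:
  assumes "sq_integrable u"
  shows "(\<integral>\<^sup>+z. ennreal (cmod (u z)) \<partial>circle) \<le> ennreal (norm (abs_L2 u))"
proof -
  have [measurable]: "u \<in> borel_measurable borel" using assms by (simp add: sq_integrable_def)
  have "(\<integral>\<^sup>+z. ennreal (cmod (u z)) * 1 \<partial>circle)\<^sup>2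
      \<le> (\<integral>\<^sup>+z. (ennreal (cmod (u z)))\<^sup>2 \<partial>circle) * (\<integral>\<^sup>+z. 1\<^sup>2 \<partial>circle)"
    by (rule Cauchy_Schwarz_nn_integral) auto
  also have "\<dots> = (ennreal (norm (abs_L2 u)))\<^sup>2"
    by (simp add: prob_circle ennreal_power norm_abs_L2(2)[OF assms])
  finally show ?thesis by (intro ennreal_power2_le_imp_le) simp_all
qed

text \<open>The sum of the \<open>L\<^sup>1\<close> norms is finite, hence by monotone convergence the series converges
  absolutely almost everywhere.\<close>

lemma AE_summable_L2:
  assumes u: "\<And>n. sq_integrable (u n)" and sum: "summable (\<lambda>n. norm (abs_L2 (u n)))"
  shows "AE z in circle. summable (\<lambda>n. u n z)"
proof -
  have [measurable]: "u n \<in> borel_measurable borel" for n using u[of n] by (simp add: sq_integrable_def)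
  have "(\<integral>\<^sup>+z. (\<Sum>n. ennreal (cmod (u n z))) \<partial>circle) = (\<Sum>n. \<integral>\<^sup>+z. ennreal (cmod (u n z)) \<partial>circle)"
    by (rule nn_integral_suminf) auto
  also have "\<dots> \<le> (\<Sum>n. ennreal (norm (abs_L2 (u n))))"
    by (intro suminf_le nn_integral_circle_le_norm u summableI)
  also have "\<dots> = ennreal (\<Sum>n. norm (abs_L2 (u n)))"
    using sum by (intro suminf_ennreal2) auto
  also have "\<dots> < \<infinity>" by simp
  finally have "AE z in circle. (\<Sum>n. ennreal (cmod (u n z))) \<noteq> \<infinity>"
    by (intro nn_integral_noteq_infinite) auto
  then show ?thesis
  proof eventually_elim
    case (elim z)
    then have "summable (\<lambda>n. cmod (u n z))" by (intro summable_suminf_not_top) auto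
    then show ?case by (rule summable_norm_cancel)
  qed
qed

text \<open>Fatou's lemma turns a uniform bound on the distances to \<open>v\<close> into a bound for the pointwise
  limit. Applied to a Cauchy sequence with \<open>v\<close> a late member, it gives both that the limit is in
  \<open>L\<^sup>2\<close> and that convergence is in norm.\<close>

lemma L2_limit_of_AE_limit:
  assumes u: "\<And>n. sq_integrable (u n)" and v: "sq_integrable v"
    and w[measurable]: "w \<in> borel_measurable borel"
    and lim: "AE z in circle. (\<lambda>n. u n z) \<longlonglongrightarrow> w z"
    and bound: "\<And>n. n \<ge> N \<Longrightarrow> norm (abs_L2 (u n) - abs_L2 v) \<le> e"
  shows "sq_integrable w" "norm (abs_L2 w - abs_L2 v) \<le> e"
proof -
  have [measurable]: "u n \<in> borel_measurable borel" "v \<in> borel_measurable borel" for n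
    using u[of n] v by (auto simp: sq_integrable_def)
  have e: "0 \<le> e" using bound[of N] norm_ge_zero order_trans by blast
  have "(\<integral>\<^sup>+z. ennreal ((cmod (w z - v z))\<^sup>2) \<partial>circle)
      = (\<integral>\<^sup>+z. liminf (\<lambda>n. ennreal ((cmod (u n z - v z))\<^sup>2)) \<partial>circle)"
  proof (rule nn_integral_cong_AE)
    show "AE z in circle. ennreal ((cmod (w z - v z))\<^sup>2) = liminf (\<lambda>n. ennreal ((cmod (u n z - v z))\<^sup>2))"
      using lim
    proof eventually_elim
      case (elim z)
      then have "(\<lambda>n. ennreal ((cmod (u n z - v z))\<^sup>2)) \<longlonglongrightarrow> ennreal ((cmod (w z - v z))\<^sup>2)"
        by (intro tendsto_intros)
      then show ?case by (intro lim_imp_Liminf[symmetric]) auto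
    qed
  qed
  also have "\<dots> \<le> liminf (\<lambda>n. \<integral>\<^sup>+z. ennreal ((cmod (u n z - v z))\<^sup>2) \<partial>circle)"
    by (rule nn_integral_liminf) auto
  also have "\<dots> \<le> liminf (\<lambda>n. ennreal (e\<^sup>2))"
  proof (rule Liminf_mono, rule eventually_sequentiallyI)
    fix n assume "N \<le> n"
    then show "(\<integral>\<^sup>+z. ennreal ((cmod (u n z - v z))\<^sup>2) \<partial>circle) \<le> ennreal (e\<^sup>2)"
      using bound[of n] e u v
      by (auto simp: norm_abs_L2(2)[OF sq_integrable_diff, symmetric] abs_L2_diff
               intro!: ennreal_leI power_mono)
  qed
  also have "\<dots> = ennreal (e\<^sup>2)" by (simp add: Liminf_const)
  finally have le: "(\<integral>\<^sup>+z. ennreal ((cmod (w z - v z))\<^sup>2) \<partial>circle) \<le> ennreal (e\<^sup>2)" .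
  then have "integrable circle (\<lambda>z. (cmod (w z - v z))\<^sup>2)"
    by (intro integrableI_bounded) (auto simp: le_less_trans)
  then have wv: "sq_integrable (\<lambda>z. w z - v z)" by (simp add: sq_integrable_def)
  from sq_integrable_add[OF this v] show w': "sq_integrable w" by simp
  have "(norm (abs_L2 w - abs_L2 v))\<^sup>2 \<le> e\<^sup>2"
    using le unfolding norm_abs_L2(2)[OF wv, symmetric] abs_L2_diff[OF w' v]
    by (subst (asm) ennreal_le_iff) auto
  then show "norm (abs_L2 w - abs_L2 v) \<le> e" using e by (rule power2_le_imp_le)
qed

text \<open>A Cauchy sequence has a subsequence whose increments are summable in norm; it converges
  almost everywhere, and its pointwise limit is the limit in norm of the whole sequence.\<close>

instance L2 :: complete_space
proof
  fix X :: "nat \<Rightarrow> L2" assume "Cauchy X"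
  then have "\<exists>N. \<forall>m\<ge>N. \<forall>n\<ge>N. norm (X m - X n) < (1/2)^k" for k
    by (intro CauchyD) auto
  then obtain M where M: "\<And>k m n. m \<ge> M k \<Longrightarrow> n \<ge> M k \<Longrightarrow> norm (X m - X n) < (1/2)^k"
    by metis
  \<comment> \<open>partial sums make the index sequence monotone while keeping \<open>r k \<ge> M k\<close>\<close>
  define r where "r k = sum M {..k}" for k
  have r: "M j \<le> r k" if "j \<le> k" for j k unfolding r_def using that by (intro member_le_sum) auto
  have "\<forall>n. \<exists>u. sq_integrable u \<and> X n = abs_L2 u" by (metis exists_L2_representative)
  then obtain x where x: "\<And>n. sq_integrable (x n)" "\<And>n. X n = abs_L2 (x n)" by metis
  have [measurable]: "x n \<in> borel_measurable borel" for n using x(1)[of n] by (simp add: sq_integrable_def)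
  have "summable (\<lambda>k. norm (abs_L2 (\<lambda>z. x (r (Suc k)) z - x (r k) z)))"
  proof (rule summable_comparison_test[OF _ summable_geometric[of "1/2::real"]])
    have "norm (abs_L2 (\<lambda>z. x (r (Suc k)) z - x (r k) z)) \<le> (1/2)^k" for k
      using M[of k "r (Suc k)" "r k"] r[of k k] r[of k "Suc k"] by (simp add: x abs_L2_diff)
    then show "\<exists>N. \<forall>n\<ge>N. norm (norm (abs_L2 (\<lambda>z. x (r (Suc n)) z - x (r n) z))) \<le> (1/2)^n" by simp
  qed simp
  then have "AE z in circle. summable (\<lambda>k. x (r (Suc k)) z - x (r k) z)"
    by (intro AE_summable_L2 sq_integrable_diff x)
  then have ae: "AE z in circle. (\<lambda>k. x (r k) z) \<longlonglongrightarrow> lim (\<lambda>k. x (r k) z)"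
  proof eventually_elim
    case (elim z)
    then have "(\<lambda>n. \<Sum>k<n. x (r (Suc k)) z - x (r k) z) \<longlonglongrightarrow> (\<Sum>k. x (r (Suc k)) z - x (r k) z)"
      by (rule summable_LIMSEQ)
    from tendsto_add[OF this tendsto_const[of "x (r 0) z"]]
    have "convergent (\<lambda>k. x (r k) z)"
      by (auto simp: sum_lessThan_telescope[of "\<lambda>k. x (r k) z"] convergent_def)
    then show ?case by (simp add: convergent_LIMSEQ_iff)
  qed
  let ?l = "\<lambda>z. lim (\<lambda>k. x (r k) z)"
  have l: "?l \<in> borel_measurable borel" by (rule borel_measurable_lim_metric) simp
  have "norm (abs_L2 ?l - X n) \<le> (1/2)^k" if "n \<ge> M k" for n k
  proof -
    have "norm (abs_L2 (x (r j)) - abs_L2 (x n)) \<le> (1/2)^k" if "j \<ge> k" for j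
      using M[OF _ \<open>n \<ge> M k\<close>, of "r j"] r[OF that] by (simp add: x(2))
    from L2_limit_of_AE_limit(2)[OF x(1) x(1) l ae this] show ?thesis by (simp add: x(2))
  qed
  then have *: "norm (X n - abs_L2 ?l) \<le> (1/2)^k" if "n \<ge> M k" for n k
    using that by (simp add: norm_minus_commute)
  have "X \<longlonglongrightarrow> abs_L2 ?l"
  proof (rule LIMSEQ_I)
    fix e :: real assume "0 < e"
    then obtain k where "(1/2)^k < e" using real_arch_pow_inv[of e "1/2"] by auto
    with * show "\<exists>no. \<forall>n\<ge>no. norm (X n - abs_L2 ?l) < e" by (meson le_less_trans)
  qed
  then show "convergent X" by (auto simp: convergent_def)
qed

section \<open>Uniqueness of Fourier coefficients\<close>

lemma AE_circle_cmod: "AE z in circle. cmod z = 1"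
  unfolding circle_def using measurable_cis_borel
  by (subst AE_distr_iff) auto

lemma powi_measurable [measurable]: "(\<lambda>z::complex. z powi k) \<in> borel_measurable borel"
  by (simp add: power_int_def)

lemma integrable_mult_bounded_on_circle:
  fixes f g :: "complex \<Rightarrow> complex"
  assumes f: "integrable circle f" and [measurable]: "g \<in> borel_measurable borel"
    and bound: "\<And>z. cmod z = 1 \<Longrightarrow> cmod (g z) \<le> C"
  shows "integrable circle (\<lambda>z. f z * g z)"
proof (rule Bochner_Integration.integrable_bound)
  have [measurable]: "f \<in> borel_measurable borel" using borel_measurable_integrable[OF f] by simp
  show "integrable circle (\<lambda>z. C * cmod (f z))" using f by simp
  show "(\<lambda>z. f z * g z) \<in> borel_measurable circle" by measurable
  show "AE z in circle. norm (f z * g z) \<le> norm (C * cmod (f z))"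
    using AE_circle_cmod
  proof eventually_elim
    case (elim z)
    have "cmod (g z) \<le> \<bar>C\<bar>" using bound[OF elim] by linarith
    then have "cmod (g z) * cmod (f z) \<le> \<bar>C\<bar> * cmod (f z)" by (rule mult_right_mono) simp
    then show ?case by (simp add: norm_mult abs_mult mult.commute)
  qed
qed

lemma integrable_mult_powi:
  "integrable circle f \<Longrightarrow> integrable circle (\<lambda>z. f z * z powi n)"
  by (rule integrable_mult_bounded_on_circle[where C=1]) (auto simp: norm_power_int)

text \<open>A predicate on functions rather than on classes in \<open>L\<^sup>2\<close>, so that it can be combined with
  pointwise multiplication by polynomials; integrability is what the coefficients require.\<close>

definition fourier_null :: "(complex \<Rightarrow> complex) \<Rightarrow> bool"
  where "fourier_null f \<longleftrightarrow> integrable circle f \<and> (\<forall>n. (\<integral>z. f z * z powi n \<partial>circle) = 0)"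

lemma fourier_null_add: "fourier_null f \<Longrightarrow> fourier_null g \<Longrightarrow> fourier_null (\<lambda>z. f z + g z)"
  by (auto simp: fourier_null_def distrib_right integrable_mult_powi)

lemma fourier_null_scale: "fourier_null f \<Longrightarrow> fourier_null (\<lambda>z. c * f z)"
  by (auto simp: fourier_null_def mult.assoc)

lemma fourier_null_shift:
  assumes "fourier_null f"
  shows "fourier_null (\<lambda>z. f z * z powi k)"
proof -
  have int: "integrable circle f" using assms by (simp add: fourier_null_def)
  have [measurable]: "f \<in> borel_measurable borel" using borel_measurable_integrable[OF int] by simp
  have "(\<integral>z. f z * z powi k * z powi n \<partial>circle) = (\<integral>z. f z * z powi (k + n) \<partial>circle)" for n
  proof (rule integral_cong_AE)
    show "AE z in circle. f z * z powi k * z powi n = f z * z powi (k + n)"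
      using AE_circle_cmod
    proof eventually_elim
      case (elim z)
      then have "z \<noteq> 0" by auto
      then show ?case by (simp add: power_int_add)
    qed
  qed measurable
  then show ?thesis using assms integrable_mult_powi[OF int] by (auto simp: fourier_null_def)
qed

lemma fourier_null_cong:
  assumes f: "fourier_null f" and [measurable]: "g \<in> borel_measurable borel"
    and eq: "\<And>z. cmod z = 1 \<Longrightarrow> f z = g z"
  shows "fourier_null g"
proof -
  have int: "integrable circle f" using f by (simp add: fourier_null_def)
  have [measurable]: "f \<in> borel_measurable borel" using borel_measurable_integrable[OF int] by simp
  have ae: "AE z in circle. f z = g z" using AE_circle_cmod by eventually_elim (rule eq)
  have "integrable circle g" using int ae by (subst integrable_cong_AE[of g _ f]) (auto simp: eq_commute)
  moreover have "(\<integral>z. g z * z powi n \<partial>circle) = (\<integral>z. f z * z powi n \<partial>circle)" for n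
    by (rule integral_cong_AE) (use ae in \<open>auto elim!: eventually_mono\<close>)
  ultimately show ?thesis using f by (simp add: fourier_null_def)
qed

text \<open>On the circle \<open>Re z\<close> and \<open>Im z\<close> are combinations of \<open>z\<close> and
  \<open>z\<^sup>-\<^sup>1\<close>, so multiplication by a linear form only shifts and combines Fourier coefficients.
  With \<open>f\<close> arbitrary in the induction, products of polynomials need no expansion: their factors
  act one after the other.\<close>

lemma fourier_null_mult_poly:
  assumes "real_polynomial_function p" "fourier_null f"
  shows "fourier_null (\<lambda>z. f z * of_real (p z))"
  using assms
proof (induction arbitrary: f)
  case (linear p)
  have int: "integrable circle f" using linear by (simp add: fourier_null_def)
  have [measurable]: "f \<in> borel_measurable borel" using borel_measurable_integrable[OF int] by simp
  have [measurable]: "p \<in> borel_measurable borel"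
    using linear(1) by (intro borel_measurable_continuous_onI linear_continuous_on)
  \<comment> \<open>\<open>p z = a Re z + b Im z\<close> with \<open>Re z = (z + z\<^sup>-\<^sup>1) / 2\<close> and \<open>Im z = (z - z\<^sup>-\<^sup>1) / 2\<i>\<close>\<close>
  define a b where "a = complex_of_real (p 1)" and "b = complex_of_real (p \<i>)"
  have "fourier_null (\<lambda>z. ((a - \<i> * b) / 2) * (f z * z powi 1) + ((a + \<i> * b) / 2) * (f z * z powi (-1)))"
    by (intro fourier_null_add fourier_null_scale fourier_null_shift linear)
  then show ?case
  proof (rule fourier_null_cong)
    fix z :: complex assume z: "cmod z = 1"
    interpret p: bounded_linear p by fact
    have "z = Re z *\<^sub>R 1 + Im z *\<^sub>R \<i>" by (simp add: complex_eq_iff)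
    from arg_cong[OF this, of p] have pz: "p z = Re z * p 1 + Im z * p \<i>"
      by (simp only: p.add p.scaleR real_scaleR_def)
    have inv: "z powi (-1) = cnj z"
      using z by (simp add: power_int_minus inverse_eq_divide complex_div_cnj[of 1])
    show "((a - \<i> * b) / 2) * (f z * z powi 1) + ((a + \<i> * b) / 2) * (f z * z powi (-1)) = f z * of_real (p z)"
      unfolding inv pz a_def b_def by (simp add: complex_eq_iff field_simps)
  qed measurable
next
  case (const c)
  then show ?case using fourier_null_scale[OF const, of c] by (simp add: mult.commute)
next
  case (add p q)
  then show ?case using fourier_null_add by (fastforce simp: distrib_left)
next
  case (mult p q)
  then show ?case using mult.IH(2)[OF mult.IH(1)[OF mult.prems]] by (simp add: mult.assoc)
qed

text \<open>By Stone--Weierstrass, \<open>g\<close> is within \<open>e\<close> of a polynomial on the circle, which changes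
  the integral by at most \<open>e\<close> times the \<open>L\<^sup>1\<close> norm of \<open>f\<close>.\<close>

lemma fourier_null_integral_continuous:
  fixes g :: "complex \<Rightarrow> real"
  assumes f: "fourier_null f" and g: "continuous_on UNIV g"
  shows "(\<integral>z. f z * of_real (g z) \<partial>circle) = 0"
proof -
  have int: "integrable circle f" using f by (simp add: fourier_null_def)
  have [measurable]: "f \<in> borel_measurable borel" using borel_measurable_integrable[OF int] by simp
  have [measurable]: "g \<in> borel_measurable borel" using g by (rule borel_measurable_continuous_onI)
  let ?I = "\<integral>z. f z * of_real (g z) \<partial>circle" and ?N = "\<integral>z. cmod (f z) \<partial>circle"
  have gS: "continuous_on (sphere 0 1) g" using g continuous_on_subset by blast
  obtain B where "\<forall>x\<in>sphere 0 1. \<bar>g x\<bar> \<le> B"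
    using compact_imp_bounded[OF compact_continuous_image[OF gS compact_sphere]]
    by (auto simp: bounded_iff)
  then have B: "\<bar>g z\<bar> \<le> B" if "cmod z = 1" for z using that by simp
  have intg: "integrable circle (\<lambda>z. f z * of_real (g z))"
    using B by (intro integrable_mult_bounded_on_circle[OF int]) auto
  have "cmod ?I \<le> e * ?N" if e: "0 < e" for e
  proof -
    obtain p where p: "real_polynomial_function p" "\<And>z. z \<in> sphere 0 1 \<Longrightarrow> \<bar>g z - p z\<bar> < e"
      using Stone_Weierstrass_real_polynomial_function[OF compact_sphere gS e] by blast
    have fp: "fourier_null (\<lambda>z. f z * of_real (p z))" using p f by (intro fourier_null_mult_poly)
    have intp: "integrable circle (\<lambda>z. f z * of_real (p z))" using fp by (simp add: fourier_null_def)
    have [measurable]: "(\<lambda>z. f z * of_real (p z)) \<in> borel_measurable borel"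
      using borel_measurable_integrable[OF intp] by simp
    have "(\<integral>z. f z * of_real (p z) \<partial>circle) = (\<integral>z. f z * of_real (p z) * z powi 0 \<partial>circle)" by simp
    also have "\<dots> = 0" using fp unfolding fourier_null_def by blast
    finally have "?I = (\<integral>z. f z * of_real (g z) - f z * of_real (p z) \<partial>circle)"
      using intg intp by simp
    also have "cmod \<dots> \<le> (\<integral>z. cmod (f z * of_real (g z) - f z * of_real (p z)) \<partial>circle)"
      by (rule integral_norm_bound)
    also have "\<dots> \<le> (\<integral>z. e * cmod (f z) \<partial>circle)"
    proof (rule integral_mono_AE)
      show "AE z in circle. cmod (f z * of_real (g z) - f z * of_real (p z)) \<le> e * cmod (f z)"
        using AE_circle_cmod
      proof eventually_elim
        case (elim z)
        have "f z * of_real (g z) - f z * of_real (p z) = of_real (g z - p z) * f z"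
          by (simp add: algebra_simps)
        then have "cmod (f z * of_real (g z) - f z * of_real (p z)) = \<bar>g z - p z\<bar> * cmod (f z)"
          by (simp only: norm_mult norm_of_real)
        also have "\<dots> \<le> e * cmod (f z)"
          using p(2)[of z] elim by (intro mult_right_mono) simp_all
        finally show ?case .
      qed
    qed (use intg intp int in auto)
    finally show ?thesis by simp
  qed
  note le = this
  have "cmod ?I \<le> e" if "0 < e" for e
  proof -
    \<comment> \<open>the summand \<open>1\<close> avoids a case distinction on whether the \<open>L\<^sup>1\<close> norm of \<open>f\<close> is zero\<close>
    have bound: "e / (b + 1) * b \<le> e" if "0 \<le> b" for b :: real
      using that \<open>0 < e\<close> by (simp add: pos_divide_le_eq distrib_left)
    have "cmod ?I \<le> e / (?N + 1) * ?N"
    proof (rule le)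
      have "0 \<le> ?N" by simp
      then have "0 < ?N + 1" by linarith
      with \<open>0 < e\<close> show "0 < e / (?N + 1)" by (rule divide_pos_pos)
    qed
    also have "\<dots> \<le> e" by (rule bound) simp
    finally show ?thesis .
  qed
  then have "cmod ?I \<le> 0" using field_le_epsilon[of "cmod ?I" 0] by simp
  then show ?thesis by simp
qed

text \<open>The indicator of an open set is the increasing pointwise limit of the continuous functions
  \<open>min 1 (n dist(z, - U))\<close>. The whole plane is treated apart because the distance to the empty
  set is \<open>0\<close> by convention.\<close>

lemma fourier_null_integral_open:
  assumes f: "fourier_null f" and U: "open U"
  shows "(\<integral>z. indicator U z *\<^sub>R f z \<partial>circle) = 0"
proof (cases "U = UNIV")
  case True
  have "(\<integral>z. f z * of_real 1 \<partial>circle) = 0"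
    by (rule fourier_null_integral_continuous[OF f]) simp
  then show ?thesis using True by simp
next
  case False
  have int: "integrable circle f" using f by (simp add: fourier_null_def)
  have [measurable]: "f \<in> borel_measurable borel" using borel_measurable_integrable[OF int] by simp
  have [measurable]: "U \<in> sets borel" using U by simp
  define g where "g n z = min 1 (real n * infdist z (- U))" for n z
  have g: "continuous_on UNIV (g n)" for n unfolding g_def by (intro continuous_intros)
  then have [measurable]: "g n \<in> borel_measurable borel" for n by (rule borel_measurable_continuous_onI)
  have "(\<lambda>n. \<integral>z. f z * of_real (g n z) \<partial>circle) \<longlonglongrightarrow> (\<integral>z. indicator U z *\<^sub>R f z \<partial>circle)"
  proof (rule integral_dominated_convergence[where w="\<lambda>z. cmod (f z)"])
    show "AE z in circle. (\<lambda>n. f z * of_real (g n z)) \<longlonglongrightarrow> indicator U z *\<^sub>R f z"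
    proof (rule AE_I2)
      fix z
      have "(\<lambda>n. g n z) \<longlonglongrightarrow> indicator U z"
      proof (cases "z \<in> U")
        case True
        then have pos: "0 < infdist z (- U)"
          using U False by (intro infdist_pos_not_in_closed) auto
        obtain m :: nat where m: "1 / infdist z (- U) \<le> real m" using real_arch_simple by blast
        have "g n z = 1" if "m \<le> n" for n
        proof -
          have "1 / infdist z (- U) \<le> real n" using m that by linarith
          then show ?thesis using pos by (simp add: g_def pos_divide_le_eq)
        qed
        then show ?thesis using True by (intro tendsto_eventually eventually_sequentiallyI[of m]) auto
      qed (simp add: g_def)
      then have "(\<lambda>n. f z * of_real (g n z)) \<longlonglongrightarrow> f z * of_real (indicator U z)"
        by (intro tendsto_intros)
      then show "(\<lambda>n. f z * of_real (g n z)) \<longlonglongrightarrow> indicator U z *\<^sub>R f z"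
        by (simp add: scaleR_conv_of_real mult.commute)
    qed
    have "\<bar>g n z\<bar> \<le> 1" for n z unfolding g_def using infdist_nonneg[of z "- U"] by (simp add: abs_le_iff min_def)
    then show "AE z in circle. norm (f z * of_real (g n z)) \<le> cmod (f z)" for n
      by (intro AE_I2) (simp add: norm_mult mult_left_le)
  qed (use int in auto)
  then show ?thesis
    by (simp add: fourier_null_integral_continuous[OF f g] LIMSEQ_const_iff)
qed

text \<open>The open sets form a generator of the Borel sets closed under intersection, so the integral
  of \<open>f\<close> vanishes over every Borel set.\<close>

theorem fourier_null_AE_zero:
  assumes f: "fourier_null f"
  shows "AE z in circle. f z = 0"
proof (rule circle.density_zero)
  show int: "integrable circle f" using f by (simp add: fourier_null_def)
  have intA: "integrable circle (\<lambda>z. indicator A z *\<^sub>R f z)" if "A \<in> sets borel" for A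
    using integrable_mult_indicator[OF _ int, of A] that by simp
  fix A assume "A \<in> sets circle"
  have "Int_stable {S::complex set. open S}" "{S. open S} \<subseteq> Pow (UNIV :: complex set)"
    by (auto simp: Int_stable_def)
  moreover from \<open>A \<in> sets circle\<close> have "A \<in> sigma_sets UNIV {S. open S}" by (simp add: borel_def)
  ultimately show "set_lebesgue_integral circle A f = 0"
    unfolding set_lebesgue_integral_def
  proof (induction rule: sigma_sets_induct_disjoint)
    case (basic U)
    then show ?case by (intro fourier_null_integral_open f) auto
  next
    case empty
    then show ?case by simp
  next
    case (compl B)
    then have B: "B \<in> sets borel" by (simp add: borel_def)
    have "(\<lambda>z. indicator (UNIV - B) z *\<^sub>R f z) = (\<lambda>z. f z - indicator B z *\<^sub>R f z)"
      by (auto simp: indicator_def)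
    moreover have "(\<integral>z. f z \<partial>circle) = 0"
      using fourier_null_integral_open[OF f, of UNIV] by simp
    ultimately show ?case using intA[OF B] int compl by simp
  next
    case (union B)
    then have B: "range B \<subseteq> sets borel" by (simp add: borel_def)
    have "set_lebesgue_integral circle (\<Union>i. B i) f = (\<Sum>i. set_lebesgue_integral circle (B i) f)"
    proof (rule lebesgue_integral_countable_add)
      have "(\<Union>i. B i) \<in> sets borel" using B by (intro sets.countable_UN) auto
      then show "set_integrable circle (\<Union>i. B i) f"
        unfolding set_integrable_def by (rule intA)
    qed (use B union in \<open>auto simp: disjoint_family_on_def\<close>)
    then show ?case using union by (simp add: set_lebesgue_integral_def)
  qed
qed

section \<open>Multiplication operators and monomials\<close>

lemma mult_op_add_right: "\<phi> \<cdot> (f + g) = \<phi> \<cdot> f + \<phi> \<cdot> g"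
  by transfer (auto simp: L2_rel_def Linf_rel_def distrib_left
      intro!: sq_integrable_add sq_integrable_mult)

lemma mult_op_add_left: "(\<phi> + \<psi>) \<cdot> f = \<phi> \<cdot> f + \<psi> \<cdot> f"
  by transfer (auto simp: L2_rel_def Linf_rel_def distrib_right
      intro!: sq_integrable_add sq_integrable_mult)

lemma mult_op_mult_op: "\<phi> \<cdot> (\<psi> \<cdot> f) = (\<phi> * \<psi>) \<cdot> f"
  by transfer (auto simp: L2_rel_def Linf_rel_def mult.assoc intro!: sq_integrable_mult)

lemma one_mult_op [simp]: "1 \<cdot> f = f"
  by transfer (auto simp: L2_rel_def)

lemma zero_mult_op [simp]: "0 \<cdot> f = 0"
  using mult_op_add_left[of 0 0 f] by simp

lemma mult_op_zero [simp]: "\<phi> \<cdot> 0 = 0"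
  using mult_op_add_right[of \<phi> 0 0] by simp

lemma uminus_mult_op [simp]: "(- \<phi>) \<cdot> f = - (\<phi> \<cdot> f)"
  using mult_op_add_left[of "- \<phi>" \<phi> f] by (simp add: eq_neg_iff_add_eq_0)

lemma mult_op_uminus: "\<phi> \<cdot> (- f) = - (\<phi> \<cdot> f)"
  using mult_op_add_right[of \<phi> "- f" f] by (simp add: eq_neg_iff_add_eq_0)

lemma mult_op_diff_right: "\<phi> \<cdot> (f - g) = \<phi> \<cdot> f - \<phi> \<cdot> g"
  using mult_op_add_right[of \<phi> f "- g"] by (simp add: mult_op_uminus)

lemma mult_op_scaleC: "\<phi> \<cdot> (c *\<^sub>C f) = c *\<^sub>C (\<phi> \<cdot> f)"
  by transfer (auto simp: L2_rel_def Linf_rel_def mult.left_commute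
      intro!: sq_integrable_scale sq_integrable_mult)

lemma mult_op_L2_of_Linf: "\<phi> \<cdot> L2_of_Linf \<psi> = L2_of_Linf (\<phi> * \<psi>)"
proof transfer
  fix \<phi> \<psi> assume "Linf_rel \<phi> \<phi>" "Linf_rel \<psi> \<psi>"
  then have "ess_bounded (\<lambda>z. \<phi> z * \<psi> z)" by (auto simp: Linf_rel_def intro: ess_bounded_mult)
  from sq_integrable_mult[OF this, of "\<lambda>_. 1"]
  show "L2_rel (\<lambda>z. \<phi> z * \<psi> z) (\<lambda>z. \<phi> z * \<psi> z)" by (simp add: sq_integrable_def L2_rel_def)
qed

lemma cinner_mult_op: "cinner (\<phi> \<cdot> f) g = cinner f (cnj_Linf \<phi> \<cdot> g)"
  by transfer (simp add: mult_ac)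

lemma cnj_Linf_cnj_Linf [simp]: "cnj_Linf (cnj_Linf \<phi>) = \<phi>"
  by transfer (auto simp: Linf_rel_def)

lemma cinner_mult_op_right: "cinner f (\<phi> \<cdot> g) = cinner (cnj_Linf \<phi> \<cdot> f) g"
  by (simp add: cinner_mult_op)

lemma unimodular_cnj_mult: "unimodular \<alpha> \<Longrightarrow> cnj_Linf \<alpha> * \<alpha> = 1"
proof transfer
  fix \<alpha> assume "Linf_rel \<alpha> \<alpha>" and ae: "AE z in circle. cmod (\<alpha> z) = 1"
  moreover have "AE z in circle. cnj (\<alpha> z) * \<alpha> z = 1"
    using ae
  proof eventually_elim
    case (elim z)
    then show ?case using complex_norm_square[of "\<alpha> z"] by (simp add: mult.commute)
  qed
  ultimately show "Linf_rel (\<lambda>z. cnj (\<alpha> z) * \<alpha> z) (\<lambda>_. 1)"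
    by (auto simp: Linf_rel_def intro!: ess_bounded_mult ess_bounded_cnj ess_bounded_const)
qed

lemma cnj_mult_op_cancel: "unimodular \<alpha> \<Longrightarrow> cnj_Linf \<alpha> \<cdot> (\<alpha> \<cdot> f) = f"
  by (simp add: mult_op_mult_op unimodular_cnj_mult)

lemma norm_unimodular_mult_op: "unimodular \<alpha> \<Longrightarrow> norm (\<alpha> \<cdot> f) = norm f"
  by (rule power2_eq_imp_eq) (simp_all add: norm_eq_cinner cinner_mult_op cnj_mult_op_cancel)

lemma ess_bounded_powi: "ess_bounded (\<lambda>z. z powi n)"
proof -
  have "AE z in circle. cmod (z powi n) \<le> 1"
    using AE_circle_cmod by eventually_elim (simp add: norm_power_int)
  then show ?thesis by (auto simp: ess_bounded_def)
qed

lift_definition zpow :: "int \<Rightarrow> Linf" is "\<lambda>n z. z powi n"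
  by (simp add: Linf_rel_def ess_bounded_powi)

lemma zpow_mult: "zpow m * zpow n = zpow (m + n)"
proof transfer
  fix m n
  have "AE z in circle. z powi m * z powi n = z powi (m + n)"
    using AE_circle_cmod
  proof eventually_elim
    case (elim z)
    then have "z \<noteq> 0" by auto
    then show ?case by (simp add: power_int_add)
  qed
  then show "Linf_rel (\<lambda>z. z powi m * z powi n) (\<lambda>z. z powi (m + n))"
    by (auto simp: Linf_rel_def intro!: ess_bounded_mult ess_bounded_powi)
qed

lemma cnj_powi_on_circle: "AE z in circle. cnj (z powi n) = z powi (- n)"
  using AE_circle_cmod
proof eventually_elim
  case (elim z)
  then have "cnj z = inverse z" by (simp add: inverse_eq_divide complex_div_cnj[of 1])
  then show ?case by (simp add: complex_cnj_power_int power_int_inverse power_int_minus)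
qed

lemma cnj_zpow: "cnj_Linf (zpow n) = zpow (- n)"
  by transfer (auto simp: Linf_rel_def cnj_powi_on_circle intro!: ess_bounded_cnj ess_bounded_powi
      simp del: complex_cnj_power_int)

definition monomial :: "int \<Rightarrow> L2"
  where "monomial n = L2_of_Linf (zpow n)"

lemma zpow_mult_op_monomial: "zpow m \<cdot> monomial n = monomial (m + n)"
  by (simp add: monomial_def mult_op_L2_of_Linf zpow_mult)

text \<open>On the circle the conjugate of \<open>z\<^sup>n\<close> is \<open>z\<^sup>-\<^sup>n\<close>. Being inner products, Fourier coefficients
  are continuous, which makes \<open>H2\<close> a closed subspace.\<close>

lemma fourier_coeff_eq_cinner: "fourier_coeff f n = cinner f (monomial n)"
  unfolding monomial_def
proof transfer
  fix f n assume f: "L2_rel f f"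
  then have [measurable]: "f \<in> borel_measurable borel" by (simp add: L2_rel_def sq_integrable_def)
  show "(\<integral>z. f z * z powi (- n) \<partial>circle) = (\<integral>z. f z * cnj (z powi n) \<partial>circle)"
  proof (rule integral_cong_AE)
    show "AE z in circle. f z * z powi (- n) = f z * cnj (z powi n)"
      using cnj_powi_on_circle[of n] by eventually_elim simp
  qed (auto intro!: borel_measurable_times measurable_cnj_comp simp del: complex_cnj_power_int)
qed

lemma eq_0_if_orthogonal_monomials:
  assumes "\<And>n. cinner f (monomial n) = 0"
  shows "f = 0"
proof -
  have "\<forall>n. fourier_coeff f n = 0" using assms by (simp add: fourier_coeff_eq_cinner)
  then show ?thesis
  proof transfer
    fix f assume f: "L2_rel f f" and null: "\<forall>n. (\<integral>z. f z * z powi (- n) \<partial>circle) = 0"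
    have "sq_integrable f" using f by (simp add: L2_rel_def)
    moreover have "sq_integrable (\<lambda>_. 1)" by (simp add: sq_integrable_def)
    ultimately have "integrable circle f" using integrable_sq_prod[of f "\<lambda>_. 1"] by simp
    moreover have "(\<integral>z. f z * z powi n \<partial>circle) = 0" for n
      using null[THEN spec, of "- n"] by (simp only: minus_minus)
    ultimately have "AE z in circle. f z = 0"
      by (intro fourier_null_AE_zero) (simp add: fourier_null_def)
    with f show "L2_rel f (\<lambda>_. 0)" by (simp add: L2_rel_def sq_integrable_zero)
  qed
qed

text \<open>In the angular variable \<open>z\<^sup>k\<close> has the \<open>2\<pi>\<close>-periodic primitive
  \<open>exp (\<i> k x) / (\<i> k)\<close>.\<close>

lemma integral_circle_powi:
  assumes "k \<noteq> 0"
  shows "(\<integral>z. z powi k \<partial>circle) = 0"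
proof -
  let ?F = "\<lambda>x. (1 / (\<i> * of_int k)) * cis (of_int k * x)"
  have "(\<integral>z. z powi k \<partial>circle) = (\<integral>x. cis x powi k \<partial>uniform_measure lborel {0..<2 * pi})"
    unfolding circle_def using measurable_cis_borel by (subst integral_distr) auto
  also have "\<dots> = (\<integral>x. cis (of_int k * x) \<partial>uniform_measure lborel {0..<2 * pi})"
    by (simp add: cis_power_int)
  also have "\<dots> = (\<integral>x. (indicator {0..<2 * pi} x / (2 * pi)) *\<^sub>R cis (of_int k * x) \<partial>lborel)"
  proof -
    have "uniform_measure lborel {0..<2 * pi} = density lborel (\<lambda>x. ennreal (indicator {0..<2 * pi} x / (2 * pi)))"
      unfolding uniform_measure_def
      by (intro arg_cong2[where f=density] ext refl)
         (auto simp: indicator_def ennreal_divide_numeral divide_ennreal simp flip: ennreal_1)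
    moreover have "(\<lambda>x. cis (of_int k * x)) \<in> borel_measurable lborel"
      using measurable_cis_borel by simp
    ultimately show ?thesis by (simp add: integral_density)
  qed
  also have "\<dots> = (\<integral>x. (1 / (2 * pi)) *\<^sub>R (indicator {0..2 * pi} x *\<^sub>R cis (of_int k * x)) \<partial>lborel)"
  proof (rule integral_cong_AE)
    show "AE x in lborel. (indicator {0..<2 * pi} x / (2 * pi)) *\<^sub>R cis (of_int k * x)
        = (1 / (2 * pi)) *\<^sub>R (indicator {0..2 * pi} x *\<^sub>R cis (of_int k * x))"
      using AE_lborel_singleton[of "2 * pi"] by eventually_elim (auto simp: indicator_def)
  qed (use measurable_cis_borel in auto)
  also have "\<dots> = (1 / (2 * pi)) *\<^sub>R (\<integral>x. indicator {0..2 * pi} x *\<^sub>R cis (of_int k * x) \<partial>lborel)"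
    by (rule integral_scaleR_right)
  also have "(\<integral>x. indicator {0..2 * pi} x *\<^sub>R cis (of_int k * x) \<partial>lborel) = ?F (2 * pi) - ?F 0"
  proof (rule integral_FTC_Icc)
    fix x
    show "(?F has_vector_derivative cis (of_int k * x)) (at x within {0..2 * pi})"
    proof -
      have "((\<lambda>z. 1 / (\<i> * of_int k) * exp (\<i> * of_int k * z)) has_field_derivative
          exp (\<i> * of_int k * of_real x)) (at (of_real x))"
        using assms by (auto intro!: derivative_eq_intros)
      from has_vector_derivative_real_field[OF this] show ?thesis
        by (simp add: cis_conv_exp mult.assoc)
    qed
  qed (auto intro!: continuous_intros)
  also have "?F (2 * pi) - ?F 0 = 0"
    using cis_multiple_2pi[of "of_int k"] by (simp add: mult_ac)
  finally show ?thesis by simp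
qed

lemma cinner_monomial: "m \<noteq> n \<Longrightarrow> cinner (monomial m) (monomial n) = 0"
proof -
  assume "m \<noteq> n"
  have "cinner (monomial m) (monomial n) = cinner (monomial m) (zpow n \<cdot> monomial 0)"
    by (simp add: zpow_mult_op_monomial)
  also have "\<dots> = fourier_coeff (monomial (m - n)) 0"
    unfolding cinner_mult_op_right
    by (simp add: fourier_coeff_eq_cinner cnj_zpow zpow_mult_op_monomial)
  also have "\<dots> = (\<integral>z. z powi (m - n) \<partial>circle)"
    unfolding monomial_def by transfer simp
  also have "\<dots> = 0" using \<open>m \<noteq> n\<close> by (intro integral_circle_powi) simp
  finally show ?thesis .
qed

section \<open>Hardy spaces and the orthogonal complement of a model space\<close>

lemma H2_eq_orth_compl: "H2 = orth_compl (monomial ` {..<0})"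
  by (auto simp: H2_def orth_compl_def fourier_coeff_eq_cinner)

lemma csubspace_H2: "csubspace H2" and closed_H2: "closed H2"
  by (simp_all add: H2_eq_orth_compl csubspace_orth_compl closed_orth_compl)

lemma csubspace_H2_minus: "csubspace H2_minus"
  by (simp add: H2_minus_def csubspace_orth_compl)

lemma cinner_H2_minus_H2: "f \<in> H2_minus \<Longrightarrow> g \<in> H2 \<Longrightarrow> cinner f g = 0"
  and cinner_H2_H2_minus: "f \<in> H2_minus \<Longrightarrow> g \<in> H2 \<Longrightarrow> cinner g f = 0"
  unfolding H2_minus_def by (auto dest: orth_complD)

lemma P_plus_in_H2: "P_plus f \<in> H2" and P_minus_in_H2_minus: "P_minus f \<in> H2_minus"
  unfolding P_minus_def P_plus_def H2_minus_def by (intro orth_proj csubspace_H2 closed_H2)+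

lemma P_plus_add_P_minus: "P_plus f + P_minus f = f"
  by (simp add: P_minus_def)

lemma P_plus_add:
  assumes "p \<in> H2" "m \<in> H2_minus"
  shows "P_plus (p + m) = p"
  unfolding P_plus_def using assms by (intro orth_proj_unique csubspace_H2) (auto simp: H2_minus_def)

lemma P_minus_add: "p \<in> H2 \<Longrightarrow> m \<in> H2_minus \<Longrightarrow> P_minus (p + m) = m"
  by (simp add: P_minus_def P_plus_add)

lemma cinner_P_plus_left: "cinner (P_plus f) g = cinner f (P_plus g)"
proof -
  have "cinner (P_plus f) (P_plus g + P_minus g) = cinner (P_plus f + P_minus f) (P_plus g)"
    by (simp add: cinner_add_left cinner_add_right cinner_H2_minus_H2 cinner_H2_H2_minus
        P_plus_in_H2 P_minus_in_H2_minus)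
  then show ?thesis by (simp add: P_plus_add_P_minus)
qed

lemma cinner_P_minus_left: "cinner (P_minus f) g = cinner f (P_minus g)"
  by (simp add: P_minus_def cinner_diff_left cinner_diff_right cinner_P_plus_left)

lemma monomial_in_H2: "0 \<le> n \<Longrightarrow> monomial n \<in> H2"
  by (auto simp: H2_eq_orth_compl orth_compl_def intro: cinner_monomial)

text \<open>The projection of \<open>f\<close> to \<open>H2\<close> is orthogonal to every monomial: to those with
  \<open>n < 0\<close> as an element of \<open>H2\<close>, to the others because \<open>f\<close> and \<open>P_minus f\<close> are. Completeness of the
  trigonometric system makes it zero.\<close>

lemma H2_minusI:
  assumes f: "\<And>n. 0 \<le> n \<Longrightarrow> cinner f (monomial n) = 0"
  shows "f \<in> H2_minus"
proof -
  have "cinner (P_plus f) (monomial n) = 0" for n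
  proof (cases "0 \<le> n")
    case True
    have "cinner (P_plus f) (monomial n) = cinner f (monomial n) - cinner (P_minus f) (monomial n)"
      by (simp add: P_minus_def cinner_diff_left)
    then show ?thesis
      using f True cinner_H2_minus_H2[OF P_minus_in_H2_minus monomial_in_H2] by simp
  next
    case False
    then show ?thesis using P_plus_in_H2[of f] by (auto simp: H2_def fourier_coeff_eq_cinner)
  qed
  then have "P_plus f = 0" by (rule eq_0_if_orthogonal_monomials)
  then show ?thesis using P_minus_in_H2_minus[of f] by (simp add: P_minus_def)
qed

text \<open>The function \<open>\<alpha> \<cdot> h\<close> is orthogonal to
  \<open>z\<^sup>n\<close> for \<open>n < 0\<close> because \<open>cnj_Linf \<alpha> \<cdot> z\<^sup>n\<close> is in \<open>H2_minus\<close>, and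
  that can be tested on the monomials with nonnegative exponent, where it amounts to the
  vanishing of negative Fourier coefficients of \<open>\<alpha>\<close>.\<close>

lemma inner_function_mult_H2:
  assumes \<alpha>: "inner_function \<alpha>" and h: "h \<in> H2"
  shows "\<alpha> \<cdot> h \<in> H2"
proof -
  have "cinner (\<alpha> \<cdot> h) (monomial n) = 0" if "n < 0" for n
  proof -
    have "cnj_Linf \<alpha> \<cdot> monomial n \<in> H2_minus"
    proof (rule H2_minusI)
      fix k :: int assume "0 \<le> k"
      have "cinner (cnj_Linf \<alpha> \<cdot> monomial n) (monomial k) = cinner (monomial n) (\<alpha> \<cdot> L2_of_Linf (zpow k))"
        by (simp add: cinner_mult_op monomial_def)
      also have "\<dots> = cinner (monomial n) (zpow k \<cdot> L2_of_Linf \<alpha>)"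
        by (simp add: mult_op_L2_of_Linf mult.commute)
      also have "\<dots> = cinner (monomial (n - k)) (L2_of_Linf \<alpha>)"
        by (simp add: cinner_mult_op_right cnj_zpow zpow_mult_op_monomial)
      also have "\<dots> = cnj (fourier_coeff (L2_of_Linf \<alpha>) (n - k))"
        by (subst cinner_commute) (simp add: fourier_coeff_eq_cinner)
      also have "\<dots> = 0"
        using \<alpha> \<open>n < 0\<close> \<open>0 \<le> k\<close> by (auto simp: inner_function_def H2_def)
      finally show "cinner (cnj_Linf \<alpha> \<cdot> monomial n) (monomial k) = 0" .
    qed
    then show ?thesis using h by (simp add: cinner_mult_op cinner_H2_H2_minus)
  qed
  then show ?thesis by (simp add: H2_def fourier_coeff_eq_cinner)
qed

lemma csubspace_K_perp: "csubspace (K_perp \<alpha>)" and closed_K_perp: "closed (K_perp \<alpha>)"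
  by (simp_all add: K_perp_def csubspace_orth_compl closed_orth_compl)

text \<open>The operator \<open>\<alpha> P_plus cnj_Linf \<alpha>\<close> projects onto \<open>\<alpha> \<cdot> H2\<close>, so
  for \<open>g\<close> in \<open>K_perp \<alpha>\<close> the difference \<open>r\<close> of \<open>P_plus g\<close> and its projection lies in
  the model space (here \<open>\<alpha> \<cdot> H2 \<subseteq> H2\<close> enters). It is orthogonal to \<open>g\<close>, to
  \<open>H2_minus\<close> and to \<open>\<alpha> \<cdot> H2\<close>, hence to itself.\<close>

theorem K_perp_eq:
  assumes \<alpha>: "inner_function \<alpha>"
  shows "K_perp \<alpha> = {m + \<alpha> \<cdot> p | m p. m \<in> H2_minus \<and> p \<in> H2}"
proof (intro equalityI subsetI)
  fix g assume g: "g \<in> K_perp \<alpha>"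
  define p where "p = P_plus (cnj_Linf \<alpha> \<cdot> P_plus g)"
  define r where "r = P_plus g - \<alpha> \<cdot> p"
  have p: "p \<in> H2" by (simp add: p_def P_plus_in_H2)
  have "r \<in> H2"
    unfolding r_def
    by (intro csubspace_diff[OF csubspace_H2] P_plus_in_H2 inner_function_mult_H2[OF \<alpha>] p)
  moreover have perp: "cinner r (\<alpha> \<cdot> q) = 0" if "q \<in> H2" for q
  proof -
    have "cinner r (\<alpha> \<cdot> q) = cinner (P_minus (cnj_Linf \<alpha> \<cdot> P_plus g)) q"
      using \<alpha> by (simp add: r_def cinner_mult_op_right mult_op_diff_right cnj_mult_op_cancel
          inner_function_def p_def P_minus_def)
    then show ?thesis using that by (simp add: cinner_H2_minus_H2 P_minus_in_H2_minus)
  qed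
  ultimately have "r \<in> model_space \<alpha>" by (auto simp: model_space_def orth_compl_def)
  then have "cinner g r = 0" using g by (auto simp: K_perp_def orth_compl_def)
  moreover have "r = g - P_minus g - \<alpha> \<cdot> p" by (simp add: r_def P_minus_def)
  moreover have "cinner (P_minus g) r = 0"
    using \<open>r \<in> H2\<close> by (simp add: cinner_H2_minus_H2 P_minus_in_H2_minus)
  moreover have "cinner (\<alpha> \<cdot> p) r = 0"
    using perp[OF p] by (subst cinner_commute) simp
  ultimately have "cinner r r = 0"
    using cinner_diff_left[of "g - P_minus g" "\<alpha> \<cdot> p" r] cinner_diff_left[of g "P_minus g" r] by simp
  then have "r = 0" by (rule cinner_self_eq_0)
  then have "g = P_minus g + \<alpha> \<cdot> p" by (simp add: r_def P_minus_def)
  then show "g \<in> {m + \<alpha> \<cdot> p | m p. m \<in> H2_minus \<and> p \<in> H2}"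
    using p P_minus_in_H2_minus by blast
next
  fix g assume "g \<in> {m + \<alpha> \<cdot> p | m p. m \<in> H2_minus \<and> p \<in> H2}"
  then obtain m p where g: "g = m + \<alpha> \<cdot> p" "m \<in> H2_minus" "p \<in> H2" by blast
  have "cinner g x = 0" if "x \<in> model_space \<alpha>" for x
    using that g unfolding model_space_def
    by (auto simp: cinner_add_left cinner_H2_minus_H2 dest: orth_complD)
  then show "g \<in> K_perp \<alpha>" by (simp add: K_perp_def orth_compl_def)
qed

section \<open>The two kernels and the isomorphism\<close>

text \<open>Pairing with vectors of \<open>K_perp \<alpha>\<close> removes the projection from the operator; the
  representing vector of the adjoint is the projection of \<open>cnj_Linf \<phi> \<cdot> g\<close>.\<close>

lemma ker_dual_toeplitz_adjoint:
  "ker_on (K_perp \<alpha>) (adjoint_on (K_perp \<theta>) (dual_toeplitz \<theta> \<alpha> \<phi>))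
    = {g \<in> K_perp \<alpha>. \<forall>f\<in>K_perp \<theta>. cinner (\<phi> \<cdot> f) g = 0}"
proof -
  have "adjoint_on (K_perp \<theta>) (dual_toeplitz \<theta> \<alpha> \<phi>) g = 0
      \<longleftrightarrow> (\<forall>f\<in>K_perp \<theta>. cinner (\<phi> \<cdot> f) g = 0)" if g: "g \<in> K_perp \<alpha>" for g
  proof -
    have D: "cinner (dual_toeplitz \<theta> \<alpha> \<phi> f) g = cinner (\<phi> \<cdot> f) g" for f
      using orth_complD[OF orth_proj(2)[OF csubspace_K_perp closed_K_perp, of "\<phi> \<cdot> f" \<alpha>] g]
      by (simp add: dual_toeplitz_def cinner_diff_left)
    have "cinner (\<phi> \<cdot> f) g = cinner f (orth_proj (K_perp \<theta>) (cnj_Linf \<phi> \<cdot> g))" if "f \<in> K_perp \<theta>" for f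
      using orth_complD[OF orth_proj(2)[OF csubspace_K_perp closed_K_perp, of "cnj_Linf \<phi> \<cdot> g" \<theta>] that]
      by (simp add: cinner_mult_op cinner_diff_right)
    then show ?thesis
      using adjoint_on_eq_0_iff[OF csubspace_K_perp
          orth_proj(1)[OF csubspace_K_perp closed_K_perp, of \<theta> "cnj_Linf \<phi> \<cdot> g"],
          of "dual_toeplitz \<theta> \<alpha> \<phi>" g]
      by (simp add: D)
  qed
  then show ?thesis by (auto simp: ker_on_def)
qed

text \<open>Both components of \<open>paired_op A B u\<close> involve \<open>u\<^sub>1\<close> only through
  \<open>\<theta> P_plus u\<^sub>1 + P_minus u\<^sub>1\<close>, a general element of \<open>K_perp \<theta>\<close>; collecting
  these terms in the pairing with \<open>v\<close> leaves \<open>g = v\<^sub>1 + \<alpha> v\<^sub>2\<close> as the only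
  combination of \<open>v\<close> paired with \<open>u\<^sub>1\<close>.\<close>

lemma ker_paired_adjoint:
  fixes \<phi> \<alpha> \<theta> :: Linf and A B :: "Linf ^ 2 ^ 2"
  assumes \<theta>: "inner_function \<theta>"
    and A: "A = vector [vector [\<phi> * \<theta>, - 1],
                     vector [\<phi> * \<theta> * cnj_Linf \<alpha>, 0]]"
    and B: "B = vector [vector [\<phi>, 0],
                     vector [cnj_Linf \<alpha> * \<phi>, - 1]]"
  shows "ker_on UNIV (adjoint_on UNIV (paired_op A B))
    = {v. v $ 1 \<in> H2_minus \<and> v $ 2 \<in> H2 \<and>
          (\<forall>f\<in>K_perp \<theta>. cinner (\<phi> \<cdot> f) (v $ 1 + \<alpha> \<cdot> v $ 2) = 0)}"
proof -
  have "adjoint_on UNIV (paired_op A B) v = 0 \<longleftrightarrow> v $ 1 \<in> H2_minus \<and> v $ 2 \<in> H2 \<and>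
          (\<forall>f\<in>K_perp \<theta>. cinner (\<phi> \<cdot> f) (v $ 1 + \<alpha> \<cdot> v $ 2) = 0)" for v
  proof -
    define g where "g = v $ 1 + \<alpha> \<cdot> v $ 2"
    define w where "w = P_plus (v $ 1) + P_minus (v $ 2)"
    have T1: "paired_op A B u $ 1
        = \<phi> \<cdot> (\<theta> \<cdot> P_plus (u $ 1) + P_minus (u $ 1)) - P_plus (u $ 2)" for u
      by (simp add: paired_op_def matrix_mult_op_def A B sum_2 mult_op_add_right mult_op_mult_op)
    have T2: "paired_op A B u $ 2
        = cnj_Linf \<alpha> \<cdot> \<phi> \<cdot> (\<theta> \<cdot> P_plus (u $ 1) + P_minus (u $ 1)) - P_minus (u $ 2)" for u
      by (simp add: paired_op_def matrix_mult_op_def A B sum_2 mult_op_add_right mult_op_mult_op mult_ac)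
    have T: "cinner (paired_op A B u) v
        = cinner (\<phi> \<cdot> (\<theta> \<cdot> P_plus (u $ 1) + P_minus (u $ 1))) g - cinner (u $ 2) w" for u
      by (simp add: cinner_vec_def sum_2 T1 T2 g_def w_def cinner_diff_left cinner_add_right
          cinner_P_plus_left cinner_P_minus_left cinner_mult_op[of "cnj_Linf \<alpha>"])
    \<comment> \<open>the value of the adjoint at \<open>v\<close>\<close>
    define h :: "L2 ^ 2" where
      "h = vector [P_plus (cnj_Linf \<theta> \<cdot> cnj_Linf \<phi> \<cdot> g) + P_minus (cnj_Linf \<phi> \<cdot> g), - w]"
    have "cinner (paired_op A B u) v = cinner u h" for u
      unfolding T
      by (simp add: cinner_vec_def sum_2 h_def cinner_mult_op[of \<phi>] cinner_add_left
          cinner_mult_op[of \<theta>] cinner_P_plus_left cinner_P_minus_left cinner_add_right)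
    then have "adjoint_on UNIV (paired_op A B) v = 0 \<longleftrightarrow>
        (\<forall>u::L2 ^ 2. cinner (\<phi> \<cdot> (\<theta> \<cdot> P_plus (u $ 1) + P_minus (u $ 1))) g - cinner (u $ 2) w = 0)"
      by (subst adjoint_on_eq_0_iff[where h = h]) (auto simp: csubspace_def T)
    also have "\<dots> \<longleftrightarrow> (\<forall>x y. cinner (\<phi> \<cdot> (\<theta> \<cdot> P_plus x + P_minus x)) g - cinner y w = 0)"
      by (subst forall_vector_2) simp
    also have "\<dots> \<longleftrightarrow> (\<forall>x. cinner (\<phi> \<cdot> (\<theta> \<cdot> P_plus x + P_minus x)) g = 0) \<and> w = 0" (is "?L \<longleftrightarrow> ?R")
    proof
      assume L: ?L
      have P0: "P_plus 0 = 0" "P_minus 0 = 0"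
        using P_plus_add[of 0 0] P_minus_add[of 0 0] csubspace_zero[OF csubspace_H2]
          csubspace_zero[OF csubspace_H2_minus] by auto
      \<comment> \<open>testing with \<open>u\<^sub>1 = 0\<close> and \<open>u\<^sub>2 = w\<close> isolates the norm of \<open>w\<close>\<close>
      from L[rule_format, of 0 w] have "w = 0" by (intro cinner_self_eq_0) (simp add: P0)
      with L show ?R by simp
    qed auto
    also have "w = 0 \<longleftrightarrow> v $ 1 \<in> H2_minus \<and> v $ 2 \<in> H2"
    proof
      assume "w = 0"
      from P_plus_add[OF P_plus_in_H2 P_minus_in_H2_minus, of "v $ 1" "v $ 2"]
        P_minus_add[OF P_plus_in_H2 P_minus_in_H2_minus, of "v $ 1" "v $ 2"]
        P_plus_add[of 0 0] P_minus_add[of 0 0] csubspace_zero[OF csubspace_H2]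
          csubspace_zero[OF csubspace_H2_minus]
      have "P_plus (v $ 1) = 0" "P_minus (v $ 2) = 0"
        unfolding w_def[symmetric] \<open>w = 0\<close> by auto
      then show "v $ 1 \<in> H2_minus \<and> v $ 2 \<in> H2"
        by (metis P_plus_add_P_minus P_plus_in_H2 P_minus_in_H2_minus add_0_left add_0_right)
    next
      assume *: "v $ 1 \<in> H2_minus \<and> v $ 2 \<in> H2"
      then have "P_plus (0 + v $ 1) = 0" "P_minus (v $ 2 + 0) = 0"
        by (intro P_plus_add P_minus_add csubspace_zero csubspace_H2 csubspace_H2_minus; simp)+
      then show "w = 0" by (simp add: w_def)
    qed
    also have "(\<forall>x. cinner (\<phi> \<cdot> (\<theta> \<cdot> P_plus x + P_minus x)) g = 0)
        \<longleftrightarrow> (\<forall>f\<in>K_perp \<theta>. cinner (\<phi> \<cdot> f) g = 0)" (is "?L \<longleftrightarrow> ?R")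
    proof
      assume L: ?L
      show ?R
      proof
        fix f assume "f \<in> K_perp \<theta>"
        then obtain m p where f: "f = m + \<theta> \<cdot> p" "m \<in> H2_minus" "p \<in> H2"
          unfolding K_perp_eq[OF \<theta>] by blast
        \<comment> \<open>\<open>p + m\<close> is the vector whose two projections are \<open>p\<close> and \<open>m\<close>\<close>
        with L[rule_format, of "p + m"] show "cinner (\<phi> \<cdot> f) g = 0"
          by (simp add: P_plus_add P_minus_add add.commute[of "\<theta> \<cdot> p"])
      qed
    next
      assume R: ?R
      show ?L
      proof
        fix x
        have "P_minus x + \<theta> \<cdot> P_plus x \<in> K_perp \<theta>"
          unfolding K_perp_eq[OF \<theta>] using P_minus_in_H2_minus P_plus_in_H2 by blast
        then show "cinner (\<phi> \<cdot> (\<theta> \<cdot> P_plus x + P_minus x)) g = 0"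
          using R by (simp add: add.commute)
      qed
    qed
    finally show ?thesis unfolding g_def by blast
  qed
  then show ?thesis by (simp add: ker_on_def)
qed

lemma N_star_eq:
  assumes \<alpha>: "inner_function \<alpha>" and m: "m \<in> H2_minus" and p: "p \<in> H2"
  shows "N_star \<alpha> (m + \<alpha> \<cdot> p) = vector [m, p]"
  unfolding N_star_def
proof (rule the_equality)
  fix u :: "L2 ^ 2"
  assume u: "u $ 1 \<in> H2_minus \<and> u $ 2 \<in> H2 \<and> m + \<alpha> \<cdot> p = u $ 1 + \<alpha> \<cdot> (u $ 2)"
  have *: "P_plus (\<alpha> \<cdot> p + m) = \<alpha> \<cdot> p" "P_plus (\<alpha> \<cdot> (u $ 2) + u $ 1) = \<alpha> \<cdot> (u $ 2)"
    using u m p \<alpha> by (auto intro: P_plus_add inner_function_mult_H2)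
  then have eq: "\<alpha> \<cdot> (u $ 2) = \<alpha> \<cdot> p" using u by (simp add: add.commute)
  then have "u $ 1 = m" using u by simp
  moreover from eq have "u $ 2 = p"
    using \<alpha> cnj_mult_op_cancel unfolding inner_function_def by metis
  ultimately show "u = vector [m, p]" by (simp add: vec_eq_iff forall_2)
qed (use m p in simp)

text \<open>Pythagoras, since \<open>m\<close> and \<open>\<alpha> \<cdot> p\<close> are orthogonal and multiplication by
  \<open>\<alpha>\<close> preserves the norm.\<close>

lemma norm_N_star:
  assumes \<alpha>: "inner_function \<alpha>" and m: "m \<in> H2_minus" and p: "p \<in> H2"
  shows "norm (N_star \<alpha> (m + \<alpha> \<cdot> p)) = norm (m + \<alpha> \<cdot> p)"
proof (rule power2_eq_imp_eq)
  have *: "\<alpha> \<cdot> p \<in> H2" using \<alpha> p by (rule inner_function_mult_H2)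
  have "(norm (m + \<alpha> \<cdot> p))\<^sup>2 = (norm m)\<^sup>2 + (norm (\<alpha> \<cdot> p))\<^sup>2"
    by (simp add: norm_eq_cinner cinner_add_left cinner_add_right
        cinner_H2_minus_H2[OF m *] cinner_H2_H2_minus[OF m *])
  also have "\<dots> = (norm m)\<^sup>2 + (norm p)\<^sup>2"
    using \<alpha> by (simp add: norm_unimodular_mult_op inner_function_def)
  also have "\<dots> = (norm (N_star \<alpha> (m + \<alpha> \<cdot> p)))\<^sup>2"
    by (simp add: N_star_eq[OF assms] norm_eq_cinner cinner_vec_def sum_2)
  finally show "(norm (N_star \<alpha> (m + \<alpha> \<cdot> p)))\<^sup>2 = (norm (m + \<alpha> \<cdot> p))\<^sup>2" ..
qed simp_all

theorem theorem6p2: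
  fixes \<phi> \<alpha> \<theta> :: Linf and A B :: "Linf ^ 2 ^ 2"
  assumes "inner_function \<alpha>" and "inner_function \<theta>"
    and "A = vector [vector [\<phi> * \<theta>, - 1],
                     vector [\<phi> * \<theta> * cnj_Linf \<alpha>, 0]]"
    and "B = vector [vector [\<phi>, 0],
                     vector [cnj_Linf \<alpha> * \<phi>, - 1]]"
  defines "kerD \<equiv> ker_on (K_perp \<alpha>) (adjoint_on (K_perp \<theta>) (dual_toeplitz \<theta> \<alpha> \<phi>))"
    and "kerP \<equiv> ker_on UNIV (adjoint_on UNIV (paired_op A B))"
  shows "(\<forall>g\<in>kerD. \<exists>g_minus\<in>H2_minus. \<exists>g_plus\<in>H2. g = g_minus + \<alpha> \<cdot> g_plus) \<and>
         (\<forall>g_minus\<in>H2_minus. \<forall>g_plus\<in>H2. g_minus + \<alpha> \<cdot> g_plus \<in> kerD \<longrightarrow>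
            N_star \<alpha> (g_minus + \<alpha> \<cdot> g_plus) = vector [g_minus, g_plus]) \<and>
         isomorphism_on kerD kerP (N_star \<alpha>)"
proof -
  note \<alpha> = assms(1)
  \<comment> \<open>both kernels are described by this condition, which depends on \<open>g\<close> only\<close>
  define Z where "Z g \<longleftrightarrow> (\<forall>f\<in>K_perp \<theta>. cinner (\<phi> \<cdot> f) g = 0)" for g
  have kerD: "g \<in> kerD \<longleftrightarrow> g \<in> K_perp \<alpha> \<and> Z g" for g
    by (simp add: kerD_def ker_dual_toeplitz_adjoint Z_def)
  have kerP: "v \<in> kerP \<longleftrightarrow> v $ 1 \<in> H2_minus \<and> v $ 2 \<in> H2 \<and> Z (v $ 1 + \<alpha> \<cdot> v $ 2)" for v
    by (simp add: kerP_def ker_paired_adjoint[OF assms(2-4)] Z_def)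
  have decomp: "\<exists>m\<in>H2_minus. \<exists>p\<in>H2. g = m + \<alpha> \<cdot> p" if "g \<in> K_perp \<alpha>" for g
    using that unfolding K_perp_eq[OF \<alpha>] by blast
  have sum_in: "m + \<alpha> \<cdot> p \<in> K_perp \<alpha>" if "m \<in> H2_minus" "p \<in> H2" for m p
    using that unfolding K_perp_eq[OF \<alpha>] by blast
  have N: "N_star \<alpha> g $ 1 \<in> H2_minus \<and> N_star \<alpha> g $ 2 \<in> H2
      \<and> g = N_star \<alpha> g $ 1 + \<alpha> \<cdot> N_star \<alpha> g $ 2 \<and> norm (N_star \<alpha> g) = norm g"
    if "g \<in> K_perp \<alpha>" for g
    using decomp[OF that] N_star_eq[OF \<alpha>] norm_N_star[OF \<alpha>] by fastforce
  have "clinear_on kerD (N_star \<alpha>)"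
    unfolding clinear_on_def
  proof (intro conjI ballI allI)
    fix x y assume "x \<in> kerD" "y \<in> kerD"
    then obtain m p m' p' where xy: "x = m + \<alpha> \<cdot> p" "y = m' + \<alpha> \<cdot> p'"
        and in_H2: "m \<in> H2_minus" "p \<in> H2" "m' \<in> H2_minus" "p' \<in> H2"
      using decomp kerD by metis
    have "x + y = (m + m') + \<alpha> \<cdot> (p + p')" by (simp add: xy mult_op_add_right)
    also have "N_star \<alpha> \<dots> = vector [m + m', p + p']"
      by (intro N_star_eq \<alpha> csubspace_add csubspace_H2 csubspace_H2_minus in_H2)
    finally show "N_star \<alpha> (x + y) = N_star \<alpha> x + N_star \<alpha> y"
      using in_H2 by (simp add: xy N_star_eq[OF \<alpha>] vec_eq_iff forall_2)
  next
    fix c x assume "x \<in> kerD"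
    then obtain m p where x: "x = m + \<alpha> \<cdot> p" and in_H2: "m \<in> H2_minus" "p \<in> H2"
      using decomp kerD by metis
    have "c *\<^sub>C x = c *\<^sub>C m + \<alpha> \<cdot> (c *\<^sub>C p)" by (simp add: x scaleC_add_right mult_op_scaleC)
    also have "N_star \<alpha> \<dots> = vector [c *\<^sub>C m, c *\<^sub>C p]"
      by (intro N_star_eq \<alpha> csubspace_scaleC csubspace_H2 csubspace_H2_minus in_H2)
    finally show "N_star \<alpha> (c *\<^sub>C x) = c *\<^sub>C N_star \<alpha> x"
      using in_H2 by (simp add: x N_star_eq[OF \<alpha>] vec_eq_iff forall_2 scaleC_vec_def)
  qed
  moreover have "bij_betw (N_star \<alpha>) kerD kerP"
  proof (rule bij_betw_byWitness[where f' = "\<lambda>v. v $ 1 + \<alpha> \<cdot> v $ 2"])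
    show "\<forall>g\<in>kerD. N_star \<alpha> g $ 1 + \<alpha> \<cdot> N_star \<alpha> g $ 2 = g" using N kerD by metis
    show "\<forall>v\<in>kerP. N_star \<alpha> (v $ 1 + \<alpha> \<cdot> v $ 2) = v"
      by (simp add: kerP N_star_eq[OF \<alpha>] vec_eq_iff forall_2)
    show "N_star \<alpha> ` kerD \<subseteq> kerP" using N kerD kerP by (metis image_subsetI)
    show "(\<lambda>v. v $ 1 + \<alpha> \<cdot> v $ 2) ` kerP \<subseteq> kerD" using kerD kerP sum_in by auto
  qed
  moreover have "\<forall>g\<in>kerD. norm (N_star \<alpha> g) \<le> 1 * norm g \<and> norm g \<le> 1 * norm (N_star \<alpha> g)"
    using N kerD by simp
  ultimately have "isomorphism_on kerD kerP (N_star \<alpha>)" unfolding isomorphism_on_def by blast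
  then show ?thesis using decomp kerD N_star_eq[OF \<alpha>] by blast
qed

end
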